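(* Let $N\ge2$, $\beta\ge1$, and let $\Omega\subset\mathbb{R}^N$ be a bounded convex open set. Then \[ \frac1{\beta+1}\ \le\ \left(\frac{P(\Omega)}{|\Omega|}\right)^\beta\frac1{|\Omega|}\int_\Omega d_\Omega^\beta\,dx\ \le\ N^\beta\binom{N+\beta}{N}^{-1}. \] Equality in the upper bound holds if and only if $|\Omega|=\frac{P(\Omega)\,r_\Omega}{N}$. The lower bound is asymptotically attained as $L\to\infty$ by $\Omega_L=(-\frac L2,\frac L2)^{N-1}\times(0,1)$.
   Context: $d_\Omega$ is the distance function from $\partial\Omega$, $r_\Omega$ the inradius (radius of the largest ball contained in $\Omega$), $P(\Omega)$ the De Giorgi perimeter, $|\Omega|$ the Lebesgue measure, and $\binom{N+\beta}{N}:=\frac{\Gamma(N+\beta+1)}{\Gamma(\beta+1)\Gamma(N+1)}$. *)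

theory Defs
  imports "HOL-Analysis.Analysis"
begin

definition dist_bd :: "'a::euclidean_space set \<Rightarrow> 'a \<Rightarrow> real" where
  "dist_bd \<Omega> x = infdist x (frontier \<Omega>)"

definition inradius :: "'a::euclidean_space set \<Rightarrow> real" where
  "inradius \<Omega> = Sup {r. \<exists>x. ball x r \<subseteq> \<Omega>}"

text \<open>De Giorgi perimeter: sup of the integral over the set of div phi, over
  compactly supported C^1 vector fields phi with norm at most 1
  (phi' is the continuous Frechet derivative).\<close>
definition perimeter :: "'a::euclidean_space set \<Rightarrow> real" where
  "perimeter \<Omega> = Sup {integral \<Omega> (\<lambda>x. \<Sum>i\<in>Basis. (blinfun_apply (\<phi>' x) i) \<bullet> i) | \<phi> \<phi>'.
      (\<forall>x. (\<phi> has_derivative blinfun_apply (\<phi>' x)) (at x)) \<and> continuous_on UNIV \<phi>' \<and>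
      compact (closure {x. \<phi> x \<noteq> (0::'a)}) \<and> (\<forall>x. norm (\<phi> x) \<le> 1)}"

text \<open>Generalized binomial coefficient (N+beta choose N) via Gamma.\<close>
definition gbinom :: "real \<Rightarrow> real \<Rightarrow> real" where
  "gbinom N \<beta> = Gamma (N + \<beta> + 1) / (Gamma (\<beta> + 1) * Gamma (N + 1))"

abbreviation vol :: "'a::euclidean_space set \<Rightarrow> real" where
  "vol \<Omega> \<equiv> measure lebesgue \<Omega>"

definition Ffun :: "real \<Rightarrow> 'a::euclidean_space set \<Rightarrow> real" where
  "Ffun \<beta> \<Omega> = (perimeter \<Omega> / vol \<Omega>) powr \<beta> * (1 / vol \<Omega>) *
      integral \<Omega> (\<lambda>x. dist_bd \<Omega> x powr \<beta>)"

definition slab :: "'a::euclidean_space \<Rightarrow> real \<Rightarrow> 'a set" where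
  "slab e L = {x. 0 < x \<bullet> e \<and> x \<bullet> e < 1 \<and>
      (\<forall>i\<in>Basis - {e}. - L / 2 < x \<bullet> i \<and> x \<bullet> i < L / 2)}"

end

theory Submission
  imports Defs
begin

text \<open>Write V(t) for the volume of the inner parallel set where the distance d from the boundary exceeds t,
  so that the integral of d^\<beta> is the integral of \<beta> t^(\<beta>-1) V(t). Both bounds follow from
  V(0) - t P \<le> V(t) \<le> V(0) (1 - t P / (N V(0)))^N, where the upper estimate holds up to the inradius r and forces
  r \<le> N V(0) / P. If r equals N V(0) / P, homotheties centred near an incentre show that the upper estimate
  is an equality.

  The perimeter enters through smooth approximations u of the signed distance: the soft maximum of finitely
  many supporting affine functions with unit slopes. Its gradient n satisfies |n| \<le> 1 and
  div n = \<kappa> (1 - |n|^2). The field w(u) n, with w a piecewise linear profile of slope 1/t in the collar, gives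
  the lower estimate of V(t). Testing a field against a cutoff in u gives P \<le> liminf (V(0) - V(\<epsilon>)) / \<epsilon>;
  since V^(1/N) is concave by the Brunn--Minkowski inequality, the upper estimate follows.\<close>

section \<open>The Brunn--Minkowski inequality for open sets\<close>

text \<open>The perimeter is a supremum over compactly supported C^1 fields, so bounding it from
  below takes an explicit C^1 field. The natural candidate, the gradient of the distance, jumps on
  the ridge where the nearest boundary point is not unique. The soft maximum turns this obstacle
  into a gain: div (w(u) n) = w' |n|^2 + \<kappa> w (1 - |n|^2) is a convex combination of w' and
  \<kappa> w, so wherever the slope |n| drops below 1 the curvature term replaces it, and a
  pointwise estimate suffices once \<kappa> w \<ge> 1/t on the collar. All the constants come from
  one integral: the model profile V(0) (1 - s/T)^k on (0,T) has moment V(0) T^\<beta> divided by the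
  generalized binomial of k + \<beta> over k. The lower bound is the case k = 1, T = V(0) / P; the
  upper bound is k = N, T = N V(0) / P; the slabs are compared with k = 1, T = 1/2. Equality in the
  upper bound means that the profile reaches 0 exactly at the inradius, that is r = T.\<close>

definition minkowski_sum :: "'a::ab_group_add set \<Rightarrow> 'a set \<Rightarrow> 'a set" where
  "minkowski_sum A B = (\<Union>x\<in>A. \<Union>y\<in>B. {x + y})"

lemma minkowski_sum_iff: "z \<in> minkowski_sum A B \<longleftrightarrow> (\<exists>x\<in>A. \<exists>y\<in>B. z = x + y)"
  by (auto simp: minkowski_sum_def)

lemma minkowski_sum_commute: "minkowski_sum A B = minkowski_sum B A"
  by (auto simp: minkowski_sum_iff set_eq_iff) (metis add.commute)+

lemma minkowski_sum_mono: "A \<subseteq> A' \<Longrightarrow> B \<subseteq> B' \<Longrightarrow> minkowski_sum A B \<subseteq> minkowski_sum A' B'"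
  by (auto simp: minkowski_sum_def)

lemma open_minkowski_sum:
  fixes A B :: "'a::real_normed_vector set"
  shows "open A \<Longrightarrow> open (minkowski_sum A B)"
  unfolding minkowski_sum_def by (rule open_sums) auto

lemma bounded_minkowski_sum:
  fixes A B :: "'a::real_normed_vector set"
  assumes "bounded A" "bounded B"
  shows "bounded (minkowski_sum A B)"
  unfolding minkowski_sum_def
  using bounded_sums[OF assms] by simp

lemma measure_open_pos:
  fixes S :: "'a::euclidean_space set"
  assumes "open S" "bounded S" "S \<noteq> {}"
  shows "0 < measure lebesgue S"
proof -
  have "\<not> negligible S" using assms open_not_negligible by blast
  then have "measure lebesgue S \<noteq> 0"
    using negligible_iff_measure0[OF lmeasurable_open[OF assms(2,1)]] by auto
  then show ?thesis by (simp add: less_le)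
qed

text \<open>A point of the large box splits coordinatewise: \<open>s i\<close> is its relative
  position along the edge, and taking the same relative position in both summands gives the
  decomposition. The inclusion bounds the volume of the sum from below.\<close>

lemma box_minkowski_sum:
  fixes a b c d :: "'a::euclidean_space"
  assumes "box a b \<noteq> {}" "box c d \<noteq> {}"
  shows "box (a + c) (b + d) \<subseteq> minkowski_sum (box a b) (box c d)"
proof
  fix z assume z: "z \<in> box (a + c) (b + d)"
  have ab: "a \<bullet> i < b \<bullet> i" "c \<bullet> i < d \<bullet> i" if "i \<in> Basis" for i
    using assms that by (auto simp: box_ne_empty)
  define s where "s i = ((z - a - c) \<bullet> i) / ((b - a + d - c) \<bullet> i)" for i
  have s: "0 < s i" "s i < 1" "s i * ((b - a + d - c) \<bullet> i) = (z - a - c) \<bullet> i" if "i \<in> Basis" for i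
  proof -
    have 1: "0 < (b - a + d - c) \<bullet> i" using ab[OF that] by (simp add: inner_diff_left inner_add_left)
    have 2: "0 < (z - a - c) \<bullet> i" "(z - a - c) \<bullet> i < (b - a + d - c) \<bullet> i"
      using z that by (auto simp: mem_box inner_diff_left inner_add_left algebra_simps)
    show "0 < s i" "s i < 1" "s i * ((b - a + d - c) \<bullet> i) = (z - a - c) \<bullet> i"
      unfolding s_def using 1 2 by (auto simp: divide_simps)
  qed
  define x where "x = (\<Sum>i\<in>Basis. (a \<bullet> i + s i * ((b - a) \<bullet> i)) *\<^sub>R i)"
  have x: "x \<bullet> i = a \<bullet> i + s i * ((b - a) \<bullet> i)" if "i \<in> Basis" for i
    unfolding x_def using that by simp
  have "x \<in> box a b"
    unfolding mem_box
  proof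
    fix i :: 'a assume i: "i \<in> Basis"
    have "0 < s i * ((b - a) \<bullet> i)" "s i * ((b - a) \<bullet> i) < 1 * ((b - a) \<bullet> i)"
      using s[OF i] ab[OF i] by (auto simp: inner_diff_left intro!: mult_strict_right_mono)
    then show "a \<bullet> i < x \<bullet> i \<and> x \<bullet> i < b \<bullet> i" by (auto simp: x[OF i] inner_diff_left)
  qed
  moreover have "z - x \<in> box c d"
    unfolding mem_box
  proof
    fix i :: 'a assume i: "i \<in> Basis"
    have "0 < s i * ((d - c) \<bullet> i)" "s i * ((d - c) \<bullet> i) < 1 * ((d - c) \<bullet> i)"
      using s[OF i] ab[OF i] by (auto simp: inner_diff_left intro!: mult_strict_right_mono)
    moreover have "(z - x) \<bullet> i = c \<bullet> i + s i * ((d - c) \<bullet> i)"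
      using s(3)[OF i] x[OF i] by (simp add: inner_diff_left inner_add_left algebra_simps)
    ultimately show "c \<bullet> i < (z - x) \<bullet> i \<and> (z - x) \<bullet> i < d \<bullet> i" by (auto simp: inner_diff_left)
  qed
  ultimately show "z \<in> minkowski_sum (box a b) (box c d)"
    unfolding minkowski_sum_iff by (metis add_diff_cancel_left' diff_add_cancel add.commute)
qed

text \<open>After division by the right-hand side, AM-GM applies to the ratios x i / (x i + y i) and
  y i / (x i + y i), whose arithmetic means add up to 1. With edge lengths for x and y this is
  Brunn--Minkowski for boxes.\<close>

lemma root_prod_superadditive:
  fixes x y :: "'i \<Rightarrow> real"
  assumes S: "finite S" "S \<noteq> {}" and x: "\<And>i. i \<in> S \<Longrightarrow> 0 < x i" and y: "\<And>i. i \<in> S \<Longrightarrow> 0 < y i"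
  shows "root (card S) (\<Prod>i\<in>S. x i) + root (card S) (\<Prod>i\<in>S. y i) \<le> root (card S) (\<Prod>i\<in>S. x i + y i)"
proof -
  let ?n = "card S"
  have n: "?n > 0" using S by (simp add: card_gt_0_iff)
  have amgm: "root ?n (\<Prod>i\<in>S. z i / (x i + y i)) \<le> (\<Sum>i\<in>S. z i / (x i + y i) / ?n)"
    if "\<And>i. i \<in> S \<Longrightarrow> 0 < z i" for z
  proof -
    have p: "0 < z i / (x i + y i)" if "i \<in> S" for i
      using that x y \<open>\<And>i. i \<in> S \<Longrightarrow> 0 < z i\<close> by (simp add: add_pos_pos)
    have "0 < (\<Prod>i\<in>S. z i / (x i + y i))" by (rule prod_pos) (use p in auto)
    then have "root ?n (\<Prod>i\<in>S. z i / (x i + y i)) = (\<Prod>i\<in>S. z i / (x i + y i)) powr (1 / ?n)"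
      using n by (simp add: root_powr_inverse)
    also have "\<dots> \<le> (\<Sum>i\<in>S. z i / (x i + y i) / ?n)"
      by (rule arith_geom_mean) (use S p in \<open>auto intro: less_imp_le\<close>)
    finally show ?thesis .
  qed
  have P: "0 < (\<Prod>i\<in>S. x i + y i)" by (intro prod_pos ballI) (use x y in \<open>auto intro: add_pos_pos\<close>)
  have "root ?n (\<Prod>i\<in>S. x i / (x i + y i)) + root ?n (\<Prod>i\<in>S. y i / (x i + y i))
      \<le> (\<Sum>i\<in>S. x i / (x i + y i) / ?n) + (\<Sum>i\<in>S. y i / (x i + y i) / ?n)"
    using amgm[OF x] amgm[OF y] by (simp add: add_mono)
  also have "\<dots> = (\<Sum>i\<in>S. 1 / ?n)"
  proof -
    have "x i / (x i + y i) / ?n + y i / (x i + y i) / ?n = 1 / ?n" if "i \<in> S" for i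
      using x[OF that] y[OF that] n
      by (simp add: add_divide_distrib[symmetric])
    then show ?thesis by (simp add: sum.distrib[symmetric])
  qed
  also have "\<dots> = 1" using n by simp
  finally have "root ?n (\<Prod>i\<in>S. x i) / root ?n (\<Prod>i\<in>S. x i + y i)
      + root ?n (\<Prod>i\<in>S. y i) / root ?n (\<Prod>i\<in>S. x i + y i) \<le> 1"
    by (simp add: prod_dividef real_root_divide n)
  then show ?thesis using P n by (simp add: add_divide_distrib[symmetric] divide_simps)
qed

lemma measure_box_ne:
  fixes a b :: "'a::euclidean_space"
  assumes "box a b \<noteq> {}"
  shows "measure lebesgue (box a b) = (\<Prod>i\<in>Basis. (b - a) \<bullet> i)"
proof -
  have "a \<bullet> i \<le> b \<bullet> i" if "i \<in> Basis" for i using assms that by (force simp: box_ne_empty)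
  then have "measure lborel (box a b) = (\<Prod>i\<in>Basis. (b - a) \<bullet> i)"
    by (simp add: measure_lborel_box_eq)
  then show ?thesis by (simp add: measure_completion)
qed

lemma brunn_minkowski_boxes:
  fixes a b c d :: "'a::euclidean_space"
  assumes "box a b \<noteq> {}" "box c d \<noteq> {}"
  shows "root DIM('a) (measure lebesgue (box a b)) + root DIM('a) (measure lebesgue (box c d))
    \<le> root DIM('a) (measure lebesgue (minkowski_sum (box a b) (box c d)))"
proof -
  have ab: "a \<bullet> i < b \<bullet> i" "c \<bullet> i < d \<bullet> i" if "i \<in> Basis" for i
    using assms that by (auto simp: box_ne_empty)
  then have ne: "box (a + c) (b + d) \<noteq> {}" by (auto simp: box_ne_empty inner_add_left add_strict_mono)
  have "root DIM('a) (measure lebesgue (box a b)) + root DIM('a) (measure lebesgue (box c d))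
    \<le> root DIM('a) (measure lebesgue (box (a + c) (b + d)))"
    unfolding measure_box_ne[OF ne] measure_box_ne[OF assms(1)] measure_box_ne[OF assms(2)]
    using root_prod_superadditive[of "Basis :: 'a set" "\<lambda>i. (b - a) \<bullet> i" "\<lambda>i. (d - c) \<bullet> i"] ab
    by (simp add: inner_diff_left inner_add_left algebra_simps)
  also have "measure lebesgue (box (a + c) (b + d)) \<le> measure lebesgue (minkowski_sum (box a b) (box c d))"
    by (rule measure_mono_fmeasurable[OF box_minkowski_sum[OF assms]])
      (auto intro!: lmeasurable_open bounded_minkowski_sum open_minkowski_sum bounded_box)
  finally show ?thesis by simp
qed

text \<open>Moving the hyperplane slightly changes the volume by at most that of a thin slab of an
  enclosing cell, so the cut volume is continuous in \<open>c\<close> and takes every intermediate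
  value.\<close>

lemma halfspace_measure_IVT:
  fixes S :: "'a::euclidean_space set"
  assumes S: "open S" "bounded S" and i: "i \<in> Basis" and \<theta>: "0 \<le> \<theta>" "\<theta> \<le> 1"
  obtains c where "measure lebesgue (S \<inter> {x. x \<bullet> i < c}) = \<theta> * measure lebesgue S"
proof -
  obtain a where a: "S \<subseteq> cbox (- a) a" using bounded_subset_cbox_symmetric[OF S(2)] by auto
  define f where "f c = measure lebesgue (S \<inter> {x. x \<bullet> i < c})" for c
  have lm: "S \<inter> {x. x \<bullet> i < c} \<in> lmeasurable" for c
    using S by (intro lmeasurable_open) (auto intro: open_Int open_halfspace_component_lt bounded_Int)
  have mono: "f c \<le> f c'" if "c \<le> c'" for c c'
    unfolding f_def by (rule measure_mono_fmeasurable) (use lm that in auto)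
  have cont: "continuous_on UNIV f"
    unfolding continuous_on_iff
  proof (intro ballI allI impI)
    fix c e :: real assume e: "0 < e"
    obtain d where d: "0 < d" "measure lborel (cbox (- a) a \<inter> {x. \<bar>x \<bullet> i - c\<bar> \<le> d}) < e"
      using content_doublesplit[OF e i] by blast
    have D: "\<bar>f c' - f c\<bar> < e" if "\<bar>c' - c\<bar> < d" for c'
    proof -
      let ?T = "cbox (- a) a \<inter> {x. \<bar>x \<bullet> i - c\<bar> \<le> d}"
      have T: "?T \<in> lmeasurable"
        using interval_doublesplit[OF i, of "-a" a c d] by simp
      have le: "f (max c c') \<le> f (min c c') + measure lebesgue ?T"
      proof -
        have "f (max c c') \<le> measure lebesgue ((S \<inter> {x. x \<bullet> i < min c c'}) \<union> ?T)"
          unfolding f_def using a that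
          by (intro measure_mono_fmeasurable fmeasurable.Un lm T fmeasurableD[OF lm]) auto
        also have "\<dots> \<le> f (min c c') + measure lebesgue ?T"
          unfolding f_def by (intro measure_Un_le fmeasurableD lm T)
        finally show ?thesis .
      qed
      have "measure lebesgue ?T < e" using d(2) by (simp add: measure_completion interval_doublesplit[OF i])
      then show ?thesis using le mono[of "min c c'" "max c c'"]
        by (auto simp: min_def max_def abs_if split: if_splits)
    qed
    show "\<exists>d>0. \<forall>c'\<in>UNIV. dist c' c < d \<longrightarrow> dist (f c') (f c) < e"
      using d(1) D by (auto simp: dist_real_def)
  qed
  have 0: "f (- (a \<bullet> i)) = 0"
  proof -
    have "S \<inter> {x. x \<bullet> i < - (a \<bullet> i)} = {}" using a i by (force simp: mem_box)
    then show ?thesis by (simp add: f_def)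
  qed
  \<comment> \<open>The summand 1 puts the whole enclosing cell strictly below the hyperplane, its
    upper face included.\<close>
  have 1: "f (a \<bullet> i + 1) = measure lebesgue S"
  proof -
    have "S \<inter> {x. x \<bullet> i < a \<bullet> i + 1} = S" using a i by (force simp: mem_box)
    then show ?thesis by (simp add: f_def)
  qed
  show thesis
  proof (cases "S = {}")
    case True then show ?thesis using that by simp
  next
    case False
    then have "- (a \<bullet> i) \<le> a \<bullet> i + 1" using a i by (force simp: mem_box)
    then obtain c where "f c = \<theta> * measure lebesgue S"
      using IVT'[of f "- (a \<bullet> i)" "\<theta> * measure lebesgue S" "a \<bullet> i + 1"] cont \<theta>
      by (auto simp: 0 1 mult_left_le_one_le intro: continuous_on_subset)
    then show ?thesis using that by (simp add: f_def)
  qed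
qed


section \<open>Finite families of disjoint open boxes\<close>

definition box_family :: "'a::euclidean_space set set \<Rightarrow> bool" where
  "box_family D \<longleftrightarrow> finite D \<and> D \<noteq> {} \<and> (\<forall>K\<in>D. K \<noteq> {} \<and> (\<exists>a b. K = box a b)) \<and> pairwise disjnt D"

lemma box_family_Union:
  assumes "box_family D"
  shows "open (\<Union>D)" "bounded (\<Union>D)" "\<Union>D \<noteq> {}"
proof -
  have "open K" "bounded K" "K \<noteq> {}" if "K \<in> D" for K
    using assms that unfolding box_family_def by (metis open_box, metis bounded_box, metis)
  then show "open (\<Union>D)" "bounded (\<Union>D)" "\<Union>D \<noteq> {}"
    using assms unfolding box_family_def by (blast intro: bounded_Union)+
qed

lemma box_halfspaces:
  fixes a b i :: "'a::euclidean_space"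
  assumes "i \<in> Basis"
  shows "\<exists>a' b'. box a b \<inter> {x. x \<bullet> i < c} = box a' b'" "\<exists>a' b'. box a b \<inter> {x. c < x \<bullet> i} = box a' b'"
proof -
  define b' where "b' = (\<Sum>j\<in>Basis. (if j = i then min (b \<bullet> i) c else b \<bullet> j) *\<^sub>R j)"
  define a' where "a' = (\<Sum>j\<in>Basis. (if j = i then max (a \<bullet> i) c else a \<bullet> j) *\<^sub>R j)"
  have "box a b \<inter> {x. x \<bullet> i < c} = box a b'"
    using assms by (fastforce simp: b'_def mem_box split: if_splits)
  moreover have "box a b \<inter> {x. c < x \<bullet> i} = box a' b"
    using assms by (fastforce simp: a'_def mem_box split: if_splits)
  ultimately show "\<exists>a' b'. box a b \<inter> {x. x \<bullet> i < c} = box a' b'" "\<exists>a' b'. box a b \<inter> {x. c < x \<bullet> i} = box a' b'"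
    by blast+
qed

text \<open>Members that miss \<open>H\<close> disappear. The cardinality bound records this loss,
  on which the induction on the number of boxes rests.\<close>

lemma box_family_restrict:
  assumes D: "box_family D" and H: "\<And>a b. \<exists>a' b'. box a b \<inter> H = box a' b'" and ne: "\<Union>D \<inter> H \<noteq> {}"
  obtains D' where "box_family D'" "\<Union>D' = \<Union>D \<inter> H" "card D' \<le> card {K\<in>D. K \<inter> H \<noteq> {}}"
proof
  let ?D = "{K\<in>D. K \<inter> H \<noteq> {}}"
  let ?D' = "(\<lambda>K. K \<inter> H) ` ?D"
  have fin: "finite D" using D by (simp add: box_family_def)
  show "\<Union>?D' = \<Union>D \<inter> H" by auto
  show "card ?D' \<le> card ?D" using fin by (intro card_image_le) auto
  have "\<exists>a b. K \<inter> H = box a b" if "K \<in> D" for K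
    using D H that unfolding box_family_def by metis
  moreover have "pairwise disjnt ?D'"
    using D unfolding box_family_def pairwise_def disjnt_def by blast
  ultimately show "box_family ?D'"
    using fin ne unfolding box_family_def by auto
qed

text \<open>Two disjoint nonempty boxes are separated by a coordinate hyperplane, so each open side
  misses one of them entirely and still meets the other.\<close>

lemma box_family_split:
  fixes D :: "'a::euclidean_space set set"
  assumes D: "box_family D" and "1 < card D"
  obtains i c where "i \<in> Basis" "card {K\<in>D. K \<inter> {x. x \<bullet> i < c} \<noteq> {}} < card D"
    "card {K\<in>D. K \<inter> {x. c < x \<bullet> i} \<noteq> {}} < card D"
    "\<Union>D \<inter> {x. x \<bullet> i < c} \<noteq> {}" "\<Union>D \<inter> {x. c < x \<bullet> i} \<noteq> {}"
proof -
  note result = that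
  have fin: "finite D" using D by (simp add: box_family_def)
  obtain K L where KL: "K \<in> D" "L \<in> D" "K \<noteq> L"
    using assms(2) by (metis One_nat_def card_le_Suc0_iff_eq fin not_less)
  obtain a b c d where ab: "K = box a b" and cd: "L = box c d" and ne: "K \<noteq> {}" "L \<noteq> {}"
    using D KL unfolding box_family_def by metis
  have "K \<inter> L = {}" using D KL unfolding box_family_def pairwise_def disjnt_def by blast
  then obtain i where i: "i \<in> Basis" "b \<bullet> i \<le> c \<bullet> i \<or> d \<bullet> i \<le> a \<bullet> i"
    using ne unfolding ab cd disjoint_interval box_ne_empty by (meson not_less)
  \<comment> \<open>Neutral form with \<open>K\<close> below and \<open>L\<close> above the level
    \<open>e\<close>; the two possible orders of the boxes are instances of it.\<close>
  have *: thesis if KL: "K \<in> D" "L \<in> D" and ne: "K \<noteq> {}" "L \<noteq> {}"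
    and K: "\<And>x. x \<in> K \<Longrightarrow> x \<bullet> i < e" and L: "\<And>x. x \<in> L \<Longrightarrow> e < x \<bullet> i" for K L e
  proof (rule result[of i e])
    have "L \<inter> {x. x \<bullet> i < e} = {}" "K \<inter> {x. e < x \<bullet> i} = {}" using K L by (auto dest: less_asym)
    then have "{K\<in>D. K \<inter> {x. x \<bullet> i < e} \<noteq> {}} \<subset> D" "{K\<in>D. K \<inter> {x. e < x \<bullet> i} \<noteq> {}} \<subset> D"
      using KL by blast+
    then show "card {K\<in>D. K \<inter> {x. x \<bullet> i < e} \<noteq> {}} < card D"
      "card {K\<in>D. K \<inter> {x. e < x \<bullet> i} \<noteq> {}} < card D"
      by (simp_all only: psubset_card_mono[OF fin])
    show "\<Union>D \<inter> {x. x \<bullet> i < e} \<noteq> {}" using KL(1) K ne(1) by blast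
    show "\<Union>D \<inter> {x. e < x \<bullet> i} \<noteq> {}" using KL(2) L ne(2) by blast
  qed (use i in auto)
  from i(2) show thesis
  proof
    assume "b \<bullet> i \<le> c \<bullet> i"
    with i(1) show ?thesis by (intro *[OF KL(1,2) ne, of "b \<bullet> i"]) (force simp: ab cd mem_box)+
  next
    assume "d \<bullet> i \<le> a \<bullet> i"
    with i(1) show ?thesis by (intro *[OF KL(2,1) ne(2,1), of "d \<bullet> i"]) (force simp: ab cd mem_box)+
  qed
qed

lemma measure_halfspace_split:
  fixes S :: "'a::euclidean_space set"
  assumes "open S" "bounded S" "i \<in> Basis"
  shows "measure lebesgue S = measure lebesgue (S \<inter> {x. x \<bullet> i < c}) + measure lebesgue (S \<inter> {x. c < x \<bullet> i})"
proof -
  have lm: "S \<inter> {x. x \<bullet> i < c} \<in> lmeasurable" "S \<inter> {x. c < x \<bullet> i} \<in> lmeasurable"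
    using assms by (auto intro!: lmeasurable_open open_Int open_halfspace_component_lt open_halfspace_component_gt
        intro: bounded_Int)
  let ?T = "(S \<inter> {x. x \<bullet> i < c}) \<union> (S \<inter> {x. c < x \<bullet> i})"
  have neg: "negligible {x. x \<bullet> i = c}" using negligible_standard_hyperplane[OF assms(3)] by simp
  have "measure lebesgue S = measure lebesgue ?T"
    by (rule measure_negligible_symdiff[symmetric])
      (auto intro!: negligible_subset[OF neg] lmeasurable_open assms simp: fmeasurable.Un lm)
  also have "\<dots> = measure lebesgue (S \<inter> {x. x \<bullet> i < c}) + measure lebesgue (S \<inter> {x. c < x \<bullet> i})"
  proof (rule measure_Un3[THEN trans])
    have "S \<inter> {x. x \<bullet> i < c} \<inter> (S \<inter> {x. c < x \<bullet> i}) = {}" by auto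
    then show "measure lebesgue (S \<inter> {x. x \<bullet> i < c}) + measure lebesgue (S \<inter> {x. c < x \<bullet> i}) -
      measure lebesgue (S \<inter> {x. x \<bullet> i < c} \<inter> (S \<inter> {x. c < x \<bullet> i})) =
      measure lebesgue (S \<inter> {x. x \<bullet> i < c}) + measure lebesgue (S \<inter> {x. c < x \<bullet> i})" by simp
  qed (use lm in auto)
  finally show ?thesis .
qed

text \<open>Hadwiger--Ohmann: a coordinate hyperplane separating two boxes of the first family splits it into
  two smaller families; the second family is cut by a parallel hyperplane in the same volume ratio,
  so that the two half inequalities add up.\<close>

lemma brunn_minkowski_box_families:
  fixes D E :: "'a::euclidean_space set set"
  assumes "box_family D" "box_family E"
  shows "root DIM('a) (measure lebesgue (\<Union>D)) + root DIM('a) (measure lebesgue (\<Union>E))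
    \<le> root DIM('a) (measure lebesgue (minkowski_sum (\<Union>D) (\<Union>E)))"
  using assms
proof (induction "card D + card E" arbitrary: D E rule: less_induct)
  case (less D E)
  let ?N = "DIM('a)"
  let ?\<mu> = "measure (lebesgue :: 'a measure)"
  have N: "?N > 0" by simp
  \<comment> \<open>Stated for arbitrary families with its own induction hypothesis as a premise, so
    that it can be used again with \<open>D\<close> and \<open>E\<close> exchanged.\<close>
  have split: "root ?N (?\<mu> (\<Union>D)) + root ?N (?\<mu> (\<Union>E)) \<le> root ?N (?\<mu> (minkowski_sum (\<Union>D) (\<Union>E)))"
    if D: "box_family D" and E: "box_family E" and cD: "1 < card D"
      and IH: "\<And>D' E'. card D' + card E' < card D + card E \<Longrightarrow> box_family D' \<Longrightarrow> box_family E' \<Longrightarrow>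
        root ?N (?\<mu> (\<Union>D')) + root ?N (?\<mu> (\<Union>E')) \<le> root ?N (?\<mu> (minkowski_sum (\<Union>D') (\<Union>E')))"
    for D E :: "'a set set"
  proof -
    obtain i c where ic: "i \<in> Basis" "card {K\<in>D. K \<inter> {x. x \<bullet> i < c} \<noteq> {}} < card D"
      "card {K\<in>D. K \<inter> {x. c < x \<bullet> i} \<noteq> {}} < card D"
      "\<Union>D \<inter> {x. x \<bullet> i < c} \<noteq> {}" "\<Union>D \<inter> {x. c < x \<bullet> i} \<noteq> {}"
      by (rule box_family_split[OF D cD])
    obtain D1 where D1a: "box_family D1" "\<Union>D1 = \<Union>D \<inter> {x. x \<bullet> i < c}"
        "card D1 \<le> card {K\<in>D. K \<inter> {x. x \<bullet> i < c} \<noteq> {}}"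
      by (rule box_family_restrict[OF D box_halfspaces(1)[OF ic(1)] ic(4)])
    note D1 = D1a(1,2) le_less_trans[OF D1a(3) ic(2)]
    obtain D2 where D2a: "box_family D2" "\<Union>D2 = \<Union>D \<inter> {x. c < x \<bullet> i}"
        "card D2 \<le> card {K\<in>D. K \<inter> {x. c < x \<bullet> i} \<noteq> {}}"
      by (rule box_family_restrict[OF D box_halfspaces(2)[OF ic(1)] ic(5)])
    note D2 = D2a(1,2) le_less_trans[OF D2a(3) ic(3)]
    note oD = box_family_Union[OF D] and oE = box_family_Union[OF E]
    have D12: "?\<mu> (\<Union>D) = ?\<mu> (\<Union>D1) + ?\<mu> (\<Union>D2)"
      unfolding D1(2) D2(2) by (rule measure_halfspace_split[OF oD(1,2) ic(1)])
    have p: "0 < ?\<mu> (\<Union>D1)" "0 < ?\<mu> (\<Union>D2)" "0 < ?\<mu> (\<Union>E)"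
      using measure_open_pos box_family_Union D1(1) D2(1) E by metis+
    define \<theta> where "\<theta> = ?\<mu> (\<Union>D1) / ?\<mu> (\<Union>D)"
    have \<theta>: "0 < \<theta>" "\<theta> < 1" "?\<mu> (\<Union>D1) = \<theta> * ?\<mu> (\<Union>D)" "?\<mu> (\<Union>D2) = (1 - \<theta>) * ?\<mu> (\<Union>D)"
      using p D12 by (auto simp: \<theta>_def field_simps)
    obtain c' where c': "?\<mu> (\<Union>E \<inter> {x. x \<bullet> i < c'}) = \<theta> * ?\<mu> (\<Union>E)"
      using halfspace_measure_IVT[OF oE(1,2) ic(1), of \<theta>] \<theta> by (metis less_imp_le)
    then have c'2: "?\<mu> (\<Union>E \<inter> {x. c' < x \<bullet> i}) = (1 - \<theta>) * ?\<mu> (\<Union>E)"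
      using measure_halfspace_split[OF oE(1,2) ic(1), of c'] by (simp add: algebra_simps)
    have ne: "\<Union>E \<inter> {x. x \<bullet> i < c'} \<noteq> {}" "\<Union>E \<inter> {x. c' < x \<bullet> i} \<noteq> {}"
      using c' c'2 p \<theta> by (metis measure_empty mult_eq_0_iff less_irrefl diff_gt_0_iff_gt)+
    have cE: "card {K\<in>E. K \<inter> H \<noteq> {}} \<le> card E" for H
      using E by (intro card_mono) (auto simp: box_family_def)
    obtain E1 where E1a: "box_family E1" "\<Union>E1 = \<Union>E \<inter> {x. x \<bullet> i < c'}"
        "card E1 \<le> card {K\<in>E. K \<inter> {x. x \<bullet> i < c'} \<noteq> {}}"
      by (rule box_family_restrict[OF E box_halfspaces(1)[OF ic(1)] ne(1)])
    note E1 = E1a(1,2) order_trans[OF E1a(3) cE]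
    obtain E2 where E2a: "box_family E2" "\<Union>E2 = \<Union>E \<inter> {x. c' < x \<bullet> i}"
        "card E2 \<le> card {K\<in>E. K \<inter> {x. c' < x \<bullet> i} \<noteq> {}}"
      by (rule box_family_restrict[OF E box_halfspaces(2)[OF ic(1)] ne(2)])
    note E2 = E2a(1,2) order_trans[OF E2a(3) cE]
    let ?r = "root ?N (?\<mu> (\<Union>D)) + root ?N (?\<mu> (\<Union>E))"
    \<comment> \<open>Both pieces carry the same fraction \<open>t\<close> of their volumes, so
      \<open>root ?N t\<close> factors out of the sum of roots and the N-th power turns it back into
      \<open>t\<close>. The fractions \<theta> and 1 - \<theta> then add up to 1.\<close>
    have half: "t * ?r ^ ?N \<le> ?\<mu> (minkowski_sum (\<Union>D') (\<Union>E'))"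
      if "0 < t" "box_family D'" "box_family E'" "card D' + card E' < card D + card E"
        "?\<mu> (\<Union>D') = t * ?\<mu> (\<Union>D)" "?\<mu> (\<Union>E') = t * ?\<mu> (\<Union>E)" for t D' E'
    proof -
      have "root ?N t * ?r \<le> root ?N (?\<mu> (minkowski_sum (\<Union>D') (\<Union>E')))"
        using IH[OF that(4,2,3)] by (simp add: that(5,6) real_root_mult distrib_left)
      then have "(root ?N t * ?r) ^ ?N \<le> (root ?N (?\<mu> (minkowski_sum (\<Union>D') (\<Union>E')))) ^ ?N"
        using that(1) by (intro power_mono) auto
      then show ?thesis using that(1) N by (simp add: power_mult_distrib)
    qed
    let ?M1 = "minkowski_sum (\<Union>D1) (\<Union>E1)" and ?M2 = "minkowski_sum (\<Union>D2) (\<Union>E2)"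
    have lm: "minkowski_sum (\<Union>A) (\<Union>B) \<in> lmeasurable" if "box_family A" "box_family B" for A B :: "'a set set"
      using box_family_Union that by (intro lmeasurable_open bounded_minkowski_sum open_minkowski_sum) auto
    have "?r ^ ?N = \<theta> * ?r ^ ?N + (1 - \<theta>) * ?r ^ ?N" by (simp add: algebra_simps)
    also have "\<dots> \<le> ?\<mu> ?M1 + ?\<mu> ?M2"
      using D1 D2 E1 E2 \<theta> c' c'2 by (intro add_mono half) auto
    also have "\<dots> = ?\<mu> (?M1 \<union> ?M2)"
    proof (rule measure_Un3[THEN trans, symmetric])
      \<comment> \<open>The two sums lie on different sides of the hyperplane x \<bullet> i = c +
        c', so their volumes add.\<close>
      have "?M1 \<inter> ?M2 = {}"
        unfolding D1(2) D2(2) E1(2) E2(2)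
        by (auto simp: minkowski_sum_iff inner_add_left dest: arg_cong[where f = "\<lambda>x. x \<bullet> i"])
          (smt (verit) inner_add_left)
      then show "?\<mu> ?M1 + ?\<mu> ?M2 - ?\<mu> (?M1 \<inter> ?M2) = ?\<mu> ?M1 + ?\<mu> ?M2" by simp
    qed (use lm[OF D1(1) E1(1)] lm[OF D2(1) E2(1)] in auto)
    also have "\<dots> \<le> ?\<mu> (minkowski_sum (\<Union>D) (\<Union>E))"
    proof (rule measure_mono_fmeasurable)
      show "?M1 \<union> ?M2 \<subseteq> minkowski_sum (\<Union>D) (\<Union>E)"
        using minkowski_sum_mono[of "\<Union>D1" "\<Union>D" "\<Union>E1" "\<Union>E"] minkowski_sum_mono[of "\<Union>D2" "\<Union>D" "\<Union>E2" "\<Union>E"]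
        by (simp add: D1(2) D2(2) E1(2) E2(2))
    qed (use lm[OF D1(1) E1(1)] lm[OF D2(1) E2(1)] lm[OF D E] in auto)
    finally have "root ?N (?r ^ ?N) \<le> root ?N (?\<mu> (minkowski_sum (\<Union>D) (\<Union>E)))"
      by (simp add: real_root_le_iff)
    then show ?thesis by (simp add: real_root_power_cancel)
  qed
  consider "1 < card D" | "1 < card E" | "card D = 1" "card E = 1"
    using less.prems unfolding box_family_def by (metis One_nat_def Suc_lessI card_gt_0_iff)
  then show ?case
  proof cases
    case 1
    then show ?thesis using split[OF less.prems] less.hyps by blast
  next
    case 2
    have "root ?N (?\<mu> (\<Union>E)) + root ?N (?\<mu> (\<Union>D)) \<le> root ?N (?\<mu> (minkowski_sum (\<Union>E) (\<Union>D)))"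
      by (rule split[OF less.prems(2,1) 2]) (use less.hyps in \<open>auto simp: add.commute\<close>)
    then show ?thesis by (simp add: minkowski_sum_commute add.commute)
  next
    case 3
    then obtain K L where KL: "D = {K}" "E = {L}" by (metis One_nat_def card_1_singletonE)
    have "\<exists>a b. K = box a b" "\<exists>c d. L = box c d" "K \<noteq> {}" "L \<noteq> {}"
      using less.prems KL by (simp_all add: box_family_def)
    then obtain a b c d where "K = box a b" "L = box c d" "K \<noteq> {}" "L \<noteq> {}" by metis
    then show ?thesis using brunn_minkowski_boxes[of a b c d] KL by simp
  qed
qed

text \<open>Countably many closed cells exhaust the open set, and finitely many of them carry almost
  all of its volume. A division makes these non-overlapping; passing to interiors loses only faces,
  a null set.\<close>

lemma open_box_family_approx:
  fixes S :: "'a::euclidean_space set"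
  assumes S: "open S" "bounded S" "S \<noteq> {}" and e: "0 < e"
  obtains D where "box_family D" "\<Union>D \<subseteq> S" "measure lebesgue S - e < measure lebesgue (\<Union>D)"
proof -
  let ?\<mu> = "measure (lebesgue :: 'a measure)"
  have lS: "S \<in> lmeasurable" using S by (intro lmeasurable_open)
  have pS: "0 < ?\<mu> S" by (rule measure_open_pos[OF S])
  obtain \<D> where \<D>: "countable \<D>" "\<D> \<subseteq> Pow S" "\<And>X. X \<in> \<D> \<Longrightarrow> \<exists>a b. X = cbox a b" "\<Union>\<D> = S"
    using open_countable_Union_open_cbox[OF S(1)] by metis
  have "\<D> \<noteq> {}" using \<D>(4) S(3) by auto
  then obtain f where f: "\<D> = range (f :: nat \<Rightarrow> 'a set)" using \<D>(1) by (metis uncountable_def)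
  define U where "U n = (\<Union>k\<le>n. f k)" for n
  have fc: "\<exists>a b. f k = cbox a b" for k using \<D>(3) f by blast
  have fS: "f k \<subseteq> S" for k using \<D>(2) f by blast
  have US: "U n \<subseteq> S" for n using fS by (auto simp: U_def)
  have lf: "f k \<in> lmeasurable" for k using fc[of k] by auto
  have lU: "U n \<in> lmeasurable" for n unfolding U_def by (intro fmeasurable.finite_UN) (use lf in auto)
  have "(\<lambda>n. ?\<mu> (U n)) \<longlonglongrightarrow> ?\<mu> (\<Union>n. U n)"
  proof (rule Lim_measure_incseq)
    show "range U \<subseteq> sets lebesgue" using lU by auto
    show "incseq U" unfolding U_def incseq_def by (auto intro: le_trans)
    have "emeasure lebesgue (\<Union>n. U n) \<le> emeasure lebesgue S"
      using US lS by (intro emeasure_mono) (auto intro: fmeasurableD)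
    then show "emeasure lebesgue (\<Union> (range U)) \<noteq> \<infinity>"
      using fmeasurableD2[OF lS] by (auto simp: top_unique)
  qed
  also have "(\<Union>n. U n) = S" using \<D>(4) f by (auto simp: U_def)
  \<comment> \<open>The minimum with the volume of \<open>S\<close> keeps the approximating union at
    positive volume, hence the family nonempty.\<close>
  finally have "eventually (\<lambda>n. ?\<mu> S - min e (?\<mu> S) < ?\<mu> (U n)) sequentially"
    using e pS by (intro order_tendstoD(1)) auto
  then obtain n where n: "?\<mu> S - min e (?\<mu> S) < ?\<mu> (U n)" by (auto simp: eventually_sequentially)
  obtain p where p: "p division_of (U n)"
    using elementary_unions_intervals[of "f ` {..n}"] fc unfolding U_def by (metis finite_atMost finite_imageI imageE)
  define D where "D = {K \<in> interior ` p. K \<noteq> {}}"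
  have fin: "finite p" using p by auto
  have pc: "\<exists>a b. K = cbox a b" if "K \<in> p" for K using p that by auto
  have pU: "\<Union>p = U n" using p by auto
  have neg: "negligible (\<Union>(frontier ` p))"
    using fin pc by (intro negligible_Union) (auto intro!: negligible_convex_frontier, metis convex_box(1))
  have sub: "\<Union>D \<subseteq> U n" using pU interior_subset by (fastforce simp: D_def)
  have "U n - \<Union>D \<subseteq> \<Union>(frontier ` p)"
  proof
    fix x assume x: "x \<in> U n - \<Union>D"
    then obtain K where K: "K \<in> p" "x \<in> K" using pU by auto
    then have "x \<notin> interior K" using x by (auto simp: D_def)
    then show "x \<in> \<Union>(frontier ` p)" using K closure_subset by (auto simp: frontier_def)
  qed
  then have m: "?\<mu> (\<Union>D) = ?\<mu> (U n)"
    using neg sub by (intro measure_negligible_symdiff lU)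
     (auto intro!: negligible_subset[OF neg])
  have "?\<mu> (\<Union>D) > 0" using n m by (auto simp: min_def split: if_splits)
  then have "D \<noteq> {}" by auto
  moreover have "\<exists>a b. K = box a b" if "K \<in> D" for K
    using that pc unfolding D_def by (metis (mono_tags, lifting) imageE interior_cbox mem_Collect_eq)
  moreover have "pairwise disjnt D"
    using division_ofD(5)[OF p] unfolding D_def pairwise_def disjnt_def by blast
  ultimately have "box_family D" using fin by (auto simp: box_family_def D_def)
  moreover have "?\<mu> S - e < ?\<mu> (\<Union>D)" using n m by (auto simp: min_def split: if_splits)
  ultimately show thesis using that sub US by blast
qed

lemma brunn_minkowski_open:
  fixes A B :: "'a::euclidean_space set"
  assumes A: "open A" "bounded A" "A \<noteq> {}" and B: "open B" "bounded B" "B \<noteq> {}"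
  shows "root DIM('a) (measure lebesgue A) + root DIM('a) (measure lebesgue B)
    \<le> root DIM('a) (measure lebesgue (minkowski_sum A B))"
proof -
  let ?N = "DIM('a)"
  let ?\<mu> = "measure (lebesgue :: 'a measure)"
  \<comment> \<open>For large \<open>e\<close> the radicands are negative. Since \<open>root\<close>
    is monotone and continuous on the whole line, the estimate and its limit at 0 are
    unaffected.\<close>
  have e: "root ?N (?\<mu> A - e) + root ?N (?\<mu> B - e) \<le> root ?N (?\<mu> (minkowski_sum A B))" if e: "0 < e" for e
  proof -
    obtain D where D: "box_family D" "\<Union>D \<subseteq> A" "?\<mu> A - e < ?\<mu> (\<Union>D)" using open_box_family_approx[OF A e] .
    obtain E where E: "box_family E" "\<Union>E \<subseteq> B" "?\<mu> B - e < ?\<mu> (\<Union>E)" using open_box_family_approx[OF B e] .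
    have "root ?N (?\<mu> A - e) + root ?N (?\<mu> B - e) \<le> root ?N (?\<mu> (\<Union>D)) + root ?N (?\<mu> (\<Union>E))"
      using D E by (intro add_mono real_root_le_mono) auto
    also have "\<dots> \<le> root ?N (?\<mu> (minkowski_sum (\<Union>D) (\<Union>E)))"
      by (rule brunn_minkowski_box_families[OF D(1) E(1)])
    also have "\<dots> \<le> root ?N (?\<mu> (minkowski_sum A B))"
    proof (intro real_root_le_mono measure_mono_fmeasurable minkowski_sum_mono D E)
      show "minkowski_sum (\<Union>D) (\<Union>E) \<in> sets lebesgue"
        by (intro fmeasurableD lmeasurable_open bounded_minkowski_sum open_minkowski_sum box_family_Union D E)
      show "minkowski_sum A B \<in> lmeasurable"
        using A B by (intro lmeasurable_open bounded_minkowski_sum open_minkowski_sum)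
    qed auto
    finally show ?thesis .
  qed
  have "((\<lambda>e. root ?N (?\<mu> A - e) + root ?N (?\<mu> B - e)) \<longlongrightarrow> root ?N (?\<mu> A - 0) + root ?N (?\<mu> B - 0)) (at_right 0)"
    by (intro tendsto_intros)
  then have "root ?N (?\<mu> A - 0) + root ?N (?\<mu> B - 0) \<le> root ?N (?\<mu> (minkowski_sum A B))"
    by (rule tendsto_upperbound) (auto intro!: e eventually_mono[OF eventually_at_right_less])
  then show ?thesis by simp
qed

section \<open>Distance from the boundary of a convex set\<close>

definition support_fun :: "'a::euclidean_space set \<Rightarrow> 'a \<Rightarrow> real" where
  "support_fun S \<nu> = (SUP z\<in>S. \<nu> \<bullet> z)"

locale bounded_convex_open =
  fixes \<Omega> :: "'a::euclidean_space set"
  assumes bnd: "bounded \<Omega>" and conv: "convex \<Omega>" and opn: "open \<Omega>" and ne: "\<Omega> \<noteq> {}"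
begin

lemma frontier_nonempty: "frontier \<Omega> \<noteq> {}"
  using bnd ne by (auto simp: frontier_eq_empty)

text \<open>A segment from inside to outside meets the boundary. Hence inside \<Omega> the distance
  to the boundary is the distance to the complement, the form used below.\<close>

lemma dist_bd_le: "y \<notin> \<Omega> \<Longrightarrow> x \<in> \<Omega> \<Longrightarrow> dist_bd \<Omega> x \<le> dist x y"
proof -
  assume y: "y \<notin> \<Omega>" and x: "x \<in> \<Omega>"
  have "closed_segment x y \<inter> frontier \<Omega> \<noteq> {}"
    by (rule connected_Int_frontier) (use x y in auto)
  then obtain z where z: "z \<in> closed_segment x y" "z \<in> frontier \<Omega>" by auto
  then have "dist x z \<le> dist x y" using dist_in_closed_segment[of z x y] by (simp add: dist_commute)
  then show ?thesis unfolding dist_bd_def using infdist_le[OF z(2), of x] by linarith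
qed

lemma frontier_disjoint: "y \<in> frontier \<Omega> \<Longrightarrow> y \<notin> \<Omega>"
  using opn by (auto simp: frontier_def interior_open)

lemma dist_bd_attained: obtains y where "y \<notin> \<Omega>" "dist_bd \<Omega> x = dist x y"
  unfolding dist_bd_def using infdist_attains_inf[OF frontier_closed frontier_nonempty] frontier_disjoint by metis

lemma dist_bd_pos: "x \<in> \<Omega> \<Longrightarrow> 0 < dist_bd \<Omega> x"
  using dist_bd_attained[of x] by (metis zero_less_dist_iff)

lemma ball_dist_bd: "x \<in> \<Omega> \<Longrightarrow> ball x (dist_bd \<Omega> x) \<subseteq> \<Omega>"
  using dist_bd_le[of _ x] by (force simp: not_le[symmetric])

lemma le_dist_bd: "ball x r \<subseteq> \<Omega> \<Longrightarrow> r \<le> dist_bd \<Omega> x"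
  by (metis dist_bd_attained linorder_not_le mem_ball subsetD)

lemma bdd_above_inner: "bdd_above ((\<bullet>) \<nu> ` \<Omega>)"
proof -
  obtain R where "\<And>z. z \<in> \<Omega> \<Longrightarrow> norm z \<le> R" using bnd by (auto simp: bounded_iff)
  then have "\<nu> \<bullet> z \<le> norm \<nu> * R" if "z \<in> \<Omega>" for z
    using that norm_cauchy_schwarz[of \<nu> z] by (meson mult_left_mono norm_ge_zero order_trans)
  then show ?thesis by (auto intro!: bdd_aboveI)
qed

lemma inner_le_support: "z \<in> \<Omega> \<Longrightarrow> \<nu> \<bullet> z \<le> support_fun \<Omega> \<nu>"
  unfolding support_fun_def by (rule cSUP_upper[OF _ bdd_above_inner])

lemma support_le: "(\<And>z. z \<in> \<Omega> \<Longrightarrow> \<nu> \<bullet> z \<le> c) \<Longrightarrow> support_fun \<Omega> \<nu> \<le> c"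
  unfolding support_fun_def by (rule cSUP_least[OF ne])

text \<open>Allows a unit direction to be replaced by a nearby member of a finite net, at a cost
  linear in their distance.\<close>

lemma support_lipschitz:
  assumes "\<And>z. z \<in> \<Omega> \<Longrightarrow> norm z \<le> R"
  shows "support_fun \<Omega> \<nu> \<le> support_fun \<Omega> \<nu>' + norm (\<nu> - \<nu>') * R"
proof (rule support_le)
  fix z assume z: "z \<in> \<Omega>"
  have "\<nu> \<bullet> z = \<nu>' \<bullet> z + (\<nu> - \<nu>') \<bullet> z" by (simp add: inner_diff_left)
  also have "(\<nu> - \<nu>') \<bullet> z \<le> norm (\<nu> - \<nu>') * R"
    using norm_cauchy_schwarz[of "\<nu> - \<nu>'" z] assms[OF z] by (meson mult_left_mono norm_ge_zero order_trans)
  finally show "\<nu> \<bullet> z \<le> support_fun \<Omega> \<nu>' + norm (\<nu> - \<nu>') * R" using inner_le_support[OF z, of \<nu>'] by linarith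
qed

text \<open>Walking from \<open>x\<close> in direction \<nu> for any length below the distance stays
  in \<Omega>, hence below the supporting hyperplane.\<close>

lemma dist_bd_le_support:
  assumes "x \<in> \<Omega>" "norm \<nu> = 1"
  shows "dist_bd \<Omega> x \<le> support_fun \<Omega> \<nu> - \<nu> \<bullet> x"
proof (rule dense_le_bounded[OF dist_bd_pos[OF assms(1)]])
  fix s assume s: "0 < s" "s < dist_bd \<Omega> x"
  then have "x + s *\<^sub>R \<nu> \<in> \<Omega>" using ball_dist_bd[OF assms(1)] assms(2) by (auto simp: dist_norm subset_iff)
  from inner_le_support[OF this, of \<nu>] show "s \<le> support_fun \<Omega> \<nu> - \<nu> \<bullet> x"
    using assms(2) by (simp add: inner_add_right dot_square_norm)
qed

lemma exists_support:
  assumes "y \<notin> \<Omega>"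
  obtains \<nu> where "norm \<nu> = 1" "support_fun \<Omega> \<nu> \<le> \<nu> \<bullet> y"
proof -
  obtain a b where ab: "a \<noteq> 0" "\<forall>x\<in>\<Omega>. a \<bullet> x \<le> b" "\<forall>x\<in>{y}. a \<bullet> x \<ge> b"
    using separating_hyperplane_sets[OF conv convex_singleton ne, of y] assms by auto
  have "support_fun \<Omega> (a /\<^sub>R norm a) \<le> (a /\<^sub>R norm a) \<bullet> y"
  proof (rule support_le)
    fix z assume "z \<in> \<Omega>"
    then have "a \<bullet> z \<le> a \<bullet> y" using ab by force
    then show "(a /\<^sub>R norm a) \<bullet> z \<le> (a /\<^sub>R norm a) \<bullet> y" using ab(1) by (simp add: divide_simps)
  qed
  then show thesis using ab(1) by (intro that[of "a /\<^sub>R norm a"]) auto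
qed

text \<open>The direction separating \<Omega> from a nearest exterior point is optimal. Together
  with \<open>dist_bd_le_support\<close> this makes the distance inside \<Omega> a minimum of affine
  functions over unit directions, which is what the soft maximum approximates up to sign.\<close>

lemma dist_bd_support:
  obtains \<nu> where "norm \<nu> = 1" "support_fun \<Omega> \<nu> - \<nu> \<bullet> x \<le> dist_bd \<Omega> x"
proof -
  obtain y where y: "y \<notin> \<Omega>" "dist_bd \<Omega> x = dist x y" by (rule dist_bd_attained)
  obtain \<nu> where \<nu>: "norm \<nu> = 1" "support_fun \<Omega> \<nu> \<le> \<nu> \<bullet> y" by (rule exists_support[OF y(1)])
  have "\<nu> \<bullet> (y - x) \<le> norm \<nu> * norm (y - x)" by (rule norm_cauchy_schwarz)
  then show thesis using \<nu> y that[of \<nu>] by (simp add: inner_diff_right dist_norm norm_minus_commute)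
qed

text \<open>The direction that is optimal at the intermediate point bounds the distance at both
  endpoints.\<close>

lemma dist_bd_concave:
  assumes "x \<in> \<Omega>" "y \<in> \<Omega>" "0 \<le> s" "s \<le> 1"
  shows "(1 - s) * dist_bd \<Omega> x + s * dist_bd \<Omega> y \<le> dist_bd \<Omega> ((1 - s) *\<^sub>R x + s *\<^sub>R y)"
proof -
  obtain \<nu> where \<nu>: "norm \<nu> = 1"
    "support_fun \<Omega> \<nu> - \<nu> \<bullet> ((1 - s) *\<^sub>R x + s *\<^sub>R y) \<le> dist_bd \<Omega> ((1 - s) *\<^sub>R x + s *\<^sub>R y)"
    by (rule dist_bd_support)
  have "(1 - s) * dist_bd \<Omega> x + s * dist_bd \<Omega> y
    \<le> (1 - s) * (support_fun \<Omega> \<nu> - \<nu> \<bullet> x) + s * (support_fun \<Omega> \<nu> - \<nu> \<bullet> y)"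
    using assms dist_bd_le_support \<nu>(1) by (intro add_mono mult_left_mono) auto
  also have "\<dots> = support_fun \<Omega> \<nu> - \<nu> \<bullet> ((1 - s) *\<^sub>R x + s *\<^sub>R y)"
    by (simp add: algebra_simps inner_add_right)
  finally show ?thesis using \<nu>(2) by linarith
qed

end

text \<open>The witness is u = ln (\<Sum>\<nu>. exp (\<kappa> (\<nu> \<bullet> x - h \<nu>))) / \<kappa> with gradient n. The exact formula for the divergence
  of n replaces the differentiability theory of convex functions.\<close>

lemma log_sum_exp:
  fixes M :: "'a::euclidean_space set" and h :: "'a \<Rightarrow> real"
  assumes M: "finite M" "M \<noteq> {}" "\<And>\<nu>. \<nu> \<in> M \<Longrightarrow> norm \<nu> = 1" and lam: "0 < \<kappa>"
  obtains u :: "'a \<Rightarrow> real" and n :: "'a \<Rightarrow> 'a" and n' :: "'a \<Rightarrow> 'a \<Rightarrow> 'a" where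
    "\<forall>x. \<forall>\<nu>\<in>M. \<nu> \<bullet> x - h \<nu> \<le> u x"
    "\<forall>x m. (\<forall>\<nu>\<in>M. \<nu> \<bullet> x - h \<nu> \<le> m) \<longrightarrow> u x \<le> m + ln (card M) / \<kappa>"
    "\<forall>x. (u has_derivative (\<lambda>v. n x \<bullet> v)) (at x)"
    "\<forall>x. (n has_derivative n' x) (at x)"
    "\<forall>v. continuous_on UNIV (\<lambda>x. n' x v)"
    "\<forall>x. norm (n x) \<le> 1"
    "\<forall>x. (\<Sum>i\<in>Basis. n' x i \<bullet> i) = \<kappa> * (1 - (norm (n x))\<^sup>2)"
proof -
  define E where "E \<nu> x = exp (\<kappa> * (\<nu> \<bullet> x - h \<nu>))" for \<nu> x
  define S where "S x = (\<Sum>\<nu>\<in>M. E \<nu> x)" for x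
  define G where "G x = (\<Sum>\<nu>\<in>M. E \<nu> x *\<^sub>R \<nu>)" for x
  define u where "u x = ln (S x) / \<kappa>" for x
  define n where "n x = G x /\<^sub>R S x" for x
  define G' where "G' x v = (\<Sum>\<nu>\<in>M. (\<kappa> * (\<nu> \<bullet> v) * E \<nu> x) *\<^sub>R \<nu>)" for x v
  define n' where "n' x v = G' x v /\<^sub>R S x - (\<kappa> * (G x \<bullet> v) / (S x)\<^sup>2) *\<^sub>R G x" for x v
  have S0: "0 < S x" for x unfolding S_def using M by (intro sum_pos) (auto simp: E_def)
  have E: "(E \<nu> has_derivative (\<lambda>v. \<kappa> * (\<nu> \<bullet> v) * E \<nu> x)) (at x)" for \<nu> x
    unfolding E_def by (auto intro!: derivative_eq_intros)
  have S: "(S has_derivative (\<lambda>v. \<kappa> * (G x \<bullet> v))) (at x)" for x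
    unfolding S_def G_def
    by (rule has_derivative_eq_rhs, rule has_derivative_sum, rule E)
       (auto simp: inner_sum_left sum_distrib_left mult_ac)
  have G: "(G has_derivative G' x) (at x)" for x
    unfolding G_def G'_def by (intro has_derivative_sum has_derivative_scaleR_left E)
  have cS: "continuous_on UNIV S" using S by (meson continuous_at_imp_continuous_on has_derivative_continuous)
  have cG: "continuous_on UNIV G" using G by (meson continuous_at_imp_continuous_on has_derivative_continuous)
  have cE: "continuous_on UNIV (E \<nu>)" for \<nu> unfolding E_def by (intro continuous_intros)
  show thesis
  proof (rule that; intro allI ballI impI)
    fix x \<nu> assume \<nu>: "\<nu> \<in> M"
    have "E \<nu> x \<le> S x" unfolding S_def by (rule member_le_sum) (use M \<nu> in \<open>auto simp: E_def\<close>)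
    then have "\<kappa> * (\<nu> \<bullet> x - h \<nu>) \<le> ln (S x)" using S0[of x] by (simp add: E_def ln_ge_iff)
    then show "\<nu> \<bullet> x - h \<nu> \<le> u x" using lam by (simp add: u_def pos_le_divide_eq mult.commute)
  next
    fix x m assume m: "\<forall>\<nu>\<in>M. \<nu> \<bullet> x - h \<nu> \<le> m"
    have c: "0 < real (card M)" using M by (simp add: card_gt_0_iff)
    \<comment> \<open>Each of the \<open>card M\<close> summands is at most exp (\<kappa> m), so the
      soft maximum exceeds the maximum by at most ln (card M) / \<kappa>.\<close>
    have "S x \<le> (\<Sum>\<nu>\<in>M. exp (\<kappa> * m))"
      unfolding S_def E_def using m lam by (intro sum_mono) auto
    then have "ln (S x) \<le> ln (card M * exp (\<kappa> * m))" using S0[of x] by simp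
    also have "\<dots> = ln (card M) + \<kappa> * m" using c by (simp add: ln_mult)
    finally show "u x \<le> m + ln (card M) / \<kappa>" using lam by (simp add: u_def field_simps)
  next
    fix x
    have "(u has_derivative (\<lambda>v. (inverse (S x) * (\<kappa> * (G x \<bullet> v))) / \<kappa>)) (at x)"
      unfolding u_def using S0[of x] lam by (auto intro!: derivative_eq_intros S simp: fun_eq_iff)
    then show "(u has_derivative (\<lambda>v. n x \<bullet> v)) (at x)" using lam by (simp add: n_def)
    show "(n has_derivative n' x) (at x)"
      unfolding n_def n'_def using S0[of x]
      by (auto intro!: derivative_eq_intros S G simp: fun_eq_iff power2_eq_square field_simps)
    have "norm (G x) \<le> (\<Sum>\<nu>\<in>M. norm (E \<nu> x *\<^sub>R \<nu>))" unfolding G_def by (rule norm_sum)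
    also have "\<dots> = S x" unfolding S_def using M(3) by (intro sum.cong) (auto simp: E_def)
    finally show "norm (n x) \<le> 1" using S0[of x] by (simp add: n_def divide_simps)
    \<comment> \<open>Unit length enters here: the map v \<mapsto> (\<nu> \<bullet> v) \<nu> has
      trace |\<nu>|^2 = 1, so the trace of \<open>G' x\<close> is an exact multiple of
      \<open>S x\<close>.\<close>
    have "(\<Sum>i\<in>Basis. G' x i \<bullet> i) = (\<Sum>\<nu>\<in>M. \<kappa> * E \<nu> x * (\<Sum>i\<in>Basis. (\<nu> \<bullet> i) * (\<nu> \<bullet> i)))"
      unfolding G'_def inner_sum_left sum_distrib_left by (subst sum.swap) (simp add: mult_ac)
    also have "\<dots> = (\<Sum>\<nu>\<in>M. \<kappa> * E \<nu> x)"
      by (rule sum.cong) (simp_all only: euclidean_inner[symmetric] dot_square_norm M(3), simp)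
    also have "\<dots> = \<kappa> * S x" by (simp add: S_def sum_distrib_left)
    finally have G1: "(\<Sum>i\<in>Basis. G' x i \<bullet> i) = \<kappa> * S x" .
    have "(\<Sum>i\<in>Basis. n' x i \<bullet> i) = (\<Sum>i\<in>Basis. G' x i \<bullet> i) / S x - \<kappa> / (S x)\<^sup>2 * (\<Sum>i\<in>Basis. (G x \<bullet> i) * (G x \<bullet> i))"
      unfolding n'_def inner_diff_left sum_subtractf sum_distrib_left sum_divide_distrib
      by (simp add: divide_inverse mult_ac)
    also have "\<dots> = \<kappa> - \<kappa> / (S x)\<^sup>2 * (norm (G x))\<^sup>2"
      using S0[of x] by (simp add: G1 euclidean_inner[symmetric] dot_square_norm)
    also have "\<dots> = \<kappa> * (1 - (norm (n x))\<^sup>2)"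
      using S0[of x] by (simp add: n_def power_mult_distrib power_divide field_simps)
    finally show "(\<Sum>i\<in>Basis. n' x i \<bullet> i) = \<kappa> * (1 - (norm (n x))\<^sup>2)" .
  next
    fix v
    show "continuous_on UNIV (\<lambda>x. n' x v)"
      unfolding n'_def G'_def using S0 by (intro continuous_intros cS cG cE) (auto simp: less_imp_neq[symmetric])
  qed
qed

context bounded_convex_open
begin

text \<open>The soft maximum runs over a finite net of unit directions. Outside \<Omega> a lower
  bound on u is enough to make cutoffs vanish; bounded sublevel sets yield compact supports; the
  lower bound on \<kappa> lets curvature compensate for a small gradient in
  \<open>collar_le_perimeter_aux\<close>.\<close>

lemma smooth_signed_distance:
  assumes \<theta>: "0 < \<theta>"
  obtains u :: "'a \<Rightarrow> real" and n :: "'a \<Rightarrow> 'a" and n' :: "'a \<Rightarrow> 'a \<Rightarrow> 'a" and \<kappa> :: real where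
    "\<forall>x\<in>\<Omega>. \<bar>u x + dist_bd \<Omega> x\<bar> \<le> \<theta>"
    "\<forall>x. x \<notin> \<Omega> \<longrightarrow> - \<theta> \<le> u x"
    "\<forall>c. bounded {x. u x \<le> c}"
    "\<forall>x. (u has_derivative (\<lambda>v. n x \<bullet> v)) (at x)"
    "\<forall>x. (n has_derivative n' x) (at x)"
    "\<forall>v. continuous_on UNIV (\<lambda>x. n' x v)"
    "\<forall>x. norm (n x) \<le> 1"
    "\<forall>x. (\<Sum>i\<in>Basis. n' x i \<bullet> i) = \<kappa> * (1 - (norm (n x))\<^sup>2)"
    "2 / \<theta> \<le> \<kappa>"
proof -
  let ?h = "support_fun \<Omega>"
  obtain R where R: "0 < R" "\<And>z. z \<in> \<Omega> \<Longrightarrow> norm z \<le> R" using bnd by (auto simp: bounded_pos)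
  \<comment> \<open>Error budget: for norm x at most DIM R, moving the direction by \<delta> changes
    \<nu> \<bullet> x by at most \<delta> DIM R and the support function by at most \<delta> R,
    together \<theta>.\<close>
  define D where "D = (real DIM('a) + 1) * R"
  have D: "0 < D" using R by (simp add: D_def)
  define \<delta> where "\<delta> = \<theta> / D"
  have \<delta>: "0 < \<delta>" "\<delta> * D = \<theta>" using D \<theta> by (auto simp: \<delta>_def)
  obtain M0 where M0: "finite M0" "M0 \<subseteq> sphere (0::'a) 1" "sphere 0 1 \<subseteq> (\<Union>x\<in>M0. ball x \<delta>)"
    using compactE_image[OF compact_sphere, of "sphere (0::'a) 1" "\<lambda>x. ball x \<delta>"] \<delta> by (metis centre_in_ball open_ball UN_I subsetI)
  \<comment> \<open>The added vectors e and - e force u \<ge> |x \<bullet> e| - R for every basis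
    vector e, hence bounded sublevel sets.\<close>
  define M where "M = M0 \<union> Basis \<union> uminus ` Basis"
  have M: "finite M" "M \<noteq> {}" "\<And>\<nu>. \<nu> \<in> M \<Longrightarrow> norm \<nu> = 1" using M0 by (auto simp: M_def)
  have net: "\<exists>\<nu>\<in>M. norm (\<nu> - \<nu>0) < \<delta>" if "norm \<nu>0 = 1" for \<nu>0
  proof -
    have "\<nu>0 \<in> sphere 0 1" using that by simp
    then obtain \<nu> where "\<nu> \<in> M0" "\<nu>0 \<in> ball \<nu> \<delta>" using M0(3) by blast
    then show ?thesis by (auto simp: M_def dist_norm)
  qed
  \<comment> \<open>The second bound keeps the error of the soft maximum below \<theta>; the first
    is the one passed on in the conclusion.\<close>
  define \<kappa> where "\<kappa> = max (2 / \<theta>) (ln (card M) / \<theta>)"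
  have lam: "0 < \<kappa>" "2 / \<theta> \<le> \<kappa>" using \<theta> by (auto simp: \<kappa>_def less_max_iff_disj)
  have eta: "ln (card M) / \<kappa> \<le> \<theta>"
  proof -
    have "ln (card M) / \<theta> \<le> \<kappa>" by (simp add: \<kappa>_def)
    then show ?thesis using lam \<theta> by (simp add: field_simps)
  qed
  obtain u n n' where u0:
    "\<forall>x. \<forall>\<nu>\<in>M. \<nu> \<bullet> x - ?h \<nu> \<le> u x"
    "\<forall>x m. (\<forall>\<nu>\<in>M. \<nu> \<bullet> x - ?h \<nu> \<le> m) \<longrightarrow> u x \<le> m + ln (card M) / \<kappa>"
    "\<forall>x. (u has_derivative (\<lambda>v. n x \<bullet> v)) (at x)"
    "\<forall>x. (n has_derivative n' x) (at x)"
    "\<forall>v. continuous_on UNIV (\<lambda>x. n' x v)"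
    "\<forall>x. norm (n x) \<le> 1"
    "\<forall>x. (\<Sum>i\<in>Basis. n' x i \<bullet> i) = \<kappa> * (1 - (norm (n x))\<^sup>2)"
    by (rule log_sum_exp[OF M lam(1), of ?h])
  have u: "\<And>x \<nu>. \<nu> \<in> M \<Longrightarrow> \<nu> \<bullet> x - ?h \<nu> \<le> u x"
    "\<And>x m. (\<And>\<nu>. \<nu> \<in> M \<Longrightarrow> \<nu> \<bullet> x - ?h \<nu> \<le> m) \<Longrightarrow> u x \<le> m + ln (card M) / \<kappa>"
    using u0(1,2) by auto
  have coord: "\<bar>x \<bullet> e\<bar> \<le> u x + R" if e: "e \<in> Basis" for x e
  proof -
    have *: "?h \<nu> \<le> R" if "norm \<nu> = 1" for \<nu>
      by (rule support_le) (metis R(2) norm_cauchy_schwarz order_trans mult_1 that)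
    have "e \<bullet> x - ?h e \<le> u x" "(- e) \<bullet> x - ?h (- e) \<le> u x" using u(1)[of e x] u(1)[of "- e" x] e by (auto simp: M_def)
    then show ?thesis using *[of e] *[of "- e"] e by (auto simp: inner_commute abs_le_iff)
  qed
  have near: "\<nu>0 \<bullet> x - ?h \<nu>0 - \<theta> \<le> u x" if "norm \<nu>0 = 1" "norm x \<le> DIM('a) * R" for x \<nu>0
  proof -
    obtain \<nu> where \<nu>: "\<nu> \<in> M" "norm (\<nu> - \<nu>0) < \<delta>" using net[OF \<open>norm \<nu>0 = 1\<close>] by auto
    have "\<nu>0 \<bullet> x = \<nu> \<bullet> x + (\<nu>0 - \<nu>) \<bullet> x" by (simp add: inner_diff_left)
    also have "(\<nu>0 - \<nu>) \<bullet> x \<le> norm (\<nu>0 - \<nu>) * norm x" by (rule norm_cauchy_schwarz)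
    also have "\<dots> \<le> \<delta> * (DIM('a) * R)" using \<nu> that(2) \<delta> by (intro mult_mono) (auto simp: norm_minus_commute)
    finally have "\<nu>0 \<bullet> x \<le> \<nu> \<bullet> x + \<delta> * (DIM('a) * R)" by simp
    moreover have "?h \<nu> \<le> ?h \<nu>0 + \<delta> * R"
    proof -
      have "norm (\<nu> - \<nu>0) * R \<le> \<delta> * R" using \<nu> R by (intro mult_right_mono) auto
      then show ?thesis using support_lipschitz[of R \<nu> \<nu>0] R(2) by fastforce
    qed
    moreover have "\<theta> = \<delta> * (DIM('a) * R) + \<delta> * R" using \<delta>(2) by (simp add: D_def algebra_simps)
    ultimately show ?thesis using u(1)[OF \<nu>(1), of x] by linarith
  qed
  show thesis
  proof (rule that[of u n n' \<kappa>]; (intro allI ballI impI)?)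
    fix x assume x: "x \<in> \<Omega>"
    obtain \<nu> where \<nu>: "norm \<nu> = 1" "?h \<nu> - \<nu> \<bullet> x \<le> dist_bd \<Omega> x" by (rule dist_bd_support)
    have "norm x \<le> DIM('a) * R"
    proof -
      have "1 * R \<le> DIM('a) * R" using R(1) by (intro mult_right_mono) (auto simp: Suc_leI)
      then show ?thesis using R(2)[OF x] by simp
    qed
    then have "- dist_bd \<Omega> x - \<theta> \<le> u x" using near[OF \<nu>(1)] \<nu>(2) by fastforce
    moreover have "u x \<le> - dist_bd \<Omega> x + ln (card M) / \<kappa>"
      by (rule u(2)) (use dist_bd_le_support[OF x] M(3) in fastforce)
    ultimately show "\<bar>u x + dist_bd \<Omega> x\<bar> \<le> \<theta>" using eta by linarith
  next
    fix x assume x: "x \<notin> \<Omega>"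
    show "- \<theta> \<le> u x"
    \<comment> \<open>The net is accurate only on a bounded ball. A point with a coordinate of size
      at least \<open>R\<close> has u \<ge> 0 by \<open>coord\<close>; every other point lies in
      that ball.\<close>
    proof (cases "\<exists>e\<in>Basis. R \<le> \<bar>x \<bullet> e\<bar>")
      case True
      then show ?thesis using coord[of _ x] \<theta> by fastforce
    next
      case False
      have "norm x \<le> (\<Sum>e\<in>Basis. \<bar>x \<bullet> e\<bar>)" by (rule norm_le_l1)
      also have "\<dots> \<le> (\<Sum>e\<in>(Basis::'a set). R)" using False by (intro sum_mono) force
      finally have nx: "norm x \<le> DIM('a) * R" by simp
      obtain \<nu> where \<nu>: "norm \<nu> = 1" "?h \<nu> \<le> \<nu> \<bullet> x" by (rule exists_support[OF x])
      then show ?thesis using near[OF \<nu>(1) nx] by linarith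
    qed
  next
    fix c
    have "norm x \<le> DIM('a) * (c + R)" if "u x \<le> c" for x
    proof -
      have "norm x \<le> (\<Sum>e\<in>Basis. \<bar>x \<bullet> e\<bar>)" by (rule norm_le_l1)
      also have "\<dots> \<le> (\<Sum>e\<in>(Basis::'a set). c + R)" using coord[of _ x] that by (intro sum_mono) force
      finally show ?thesis by simp
    qed
    then show "bounded {x. u x \<le> c}" by (auto simp: bounded_iff)
  qed (use u0 lam in auto)
qed

end

section \<open>Perimeter and inner parallel sets\<close>

text \<open>By translation invariance every difference quotient in direction \<open>e\<close> has
  integral 0. The mean value theorem bounds the quotients uniformly, their supports stay in one
  ball, and dominated convergence passes to the derivative.\<close>

lemma integral_directional_derivative_zero:
  fixes g :: "'a::euclidean_space \<Rightarrow> real"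
  assumes g: "\<And>x. (g has_derivative g' x) (at x)" and cont: "continuous_on UNIV (\<lambda>x. g' x e)"
    and supp: "bounded {x. g x \<noteq> 0}"
  shows "((\<lambda>x. g' x e) has_integral 0) UNIV"
proof -
  define F where "F x = g' x e" for x
  obtain R where R: "\<And>x. g x \<noteq> 0 \<Longrightarrow> norm x \<le> R" using supp by (auto simp: bounded_iff)
  \<comment> \<open>Beyond radius \<open>R\<close> the function vanishes on an open set, so the
    derivative inherits the bounded support.\<close>
  have F0: "F x = 0" if "R < norm x" for x
  proof -
    have "open {x. R < norm x}" by (intro open_Collect_less continuous_intros)
    then have "((\<lambda>_. 0) has_derivative g' x) (at x)"
      by (rule has_derivative_transform_within_open[OF g]) (use that R in force)+
    then have "g' x = (\<lambda>_. 0)" by (rule has_derivative_unique[OF _ has_derivative_const])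
    then show ?thesis by (simp add: F_def)
  qed
  have cF: "continuous_on UNIV F" using cont by (simp add: F_def[abs_def])
  have "bounded (F ` cball 0 R)"
    by (intro compact_imp_bounded compact_continuous_image continuous_on_subset[OF cF]) auto
  then obtain B where B: "0 < B" "\<And>x. norm x \<le> R \<Longrightarrow> \<bar>F x\<bar> \<le> B" by (auto simp: bounded_pos)
  have FB: "\<bar>F x\<bar> \<le> B" for x using B F0[of x] by (cases "norm x \<le> R") auto
  have line: "((\<lambda>s. g (x + s *\<^sub>R e)) has_real_derivative F (x + s *\<^sub>R e)) (at s)" for x s
  proof -
    have "((\<lambda>s. g (x + s *\<^sub>R e)) has_derivative (\<lambda>h. g' (x + s *\<^sub>R e) (h *\<^sub>R e))) (at s)"
      by (rule has_derivative_compose[OF _ g]) (auto intro!: derivative_eq_intros)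
    moreover have "(\<lambda>h. g' (x + s *\<^sub>R e) (h *\<^sub>R e)) = (\<lambda>h. F (x + s *\<^sub>R e) * h)"
      using g[of "x + s *\<^sub>R e"] by (auto simp: F_def linear_simps has_derivative_bounded_linear mult.commute)
    ultimately show ?thesis by (simp add: has_field_derivative_def)
  qed
  \<comment> \<open>The steps 1, 1/2, 1/3, ... never exceed 1, so all quotients vanish outside the
    ball of radius R + norm e.\<close>
  define t where "t k = inverse (real (Suc k))" for k
  have t: "0 < t k" "t k \<le> 1" for k by (auto simp: t_def divide_simps)
  define q where "q k x = (g (t k *\<^sub>R e + x) - g x) / t k" for k x
  have cg: "continuous_on UNIV g" using g by (meson continuous_at_imp_continuous_on has_derivative_continuous)
  have gm: "g \<in> borel_measurable lborel" and Fm: "F \<in> borel_measurable lborel"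
    using cg cF by (auto intro: borel_measurable_continuous_onI)
  have qB: "\<bar>q k x\<bar> \<le> B" for k x
  proof -
    obtain s where "g (x + t k *\<^sub>R e) - g (x + 0 *\<^sub>R e) = (t k - 0) * F (x + s *\<^sub>R e)"
      using MVT2[of 0 "t k" "\<lambda>s. g (x + s *\<^sub>R e)" "\<lambda>s. F (x + s *\<^sub>R e)"] line t by blast
    then have "q k x = F (x + s *\<^sub>R e)" using t[of k] by (simp add: q_def add.commute)
    then show ?thesis using FB by simp
  qed
  have q0: "q k x = 0" if "R + norm e < norm x" for k x
  proof -
    have "norm x \<le> norm (t k *\<^sub>R e + x) + norm (t k *\<^sub>R e)" using norm_triangle_ineq4[of "t k *\<^sub>R e + x" "t k *\<^sub>R e"] by simp
    moreover have "norm (t k *\<^sub>R e) \<le> 1 * norm e"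
      unfolding norm_scaleR using t[of k] by (intro mult_right_mono) auto
    ultimately have "R < norm (t k *\<^sub>R e + x)" "R < norm x" using that norm_ge_zero[of e] by linarith+
    then have "g (t k *\<^sub>R e + x) = 0" "g x = 0" using R by (meson not_le)+
    then show ?thesis by (simp add: q_def)
  qed
  have gi: "integrable lborel g"
  proof -
    have "integrable lborel (\<lambda>x. indicator (cball 0 R) x *\<^sub>R g x)"
      by (rule borel_integrable_compact) (auto intro: continuous_on_subset[OF cg])
    moreover have "(\<lambda>x. indicator (cball 0 R) x *\<^sub>R g x) = g" using R by (force simp: indicator_def fun_eq_iff)
    ultimately show ?thesis by simp
  qed
  have tr: "integrable lborel (\<lambda>x. g (c + x))" "integral\<^sup>L lborel (\<lambda>x. g (c + x)) = integral\<^sup>L lborel g" for c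
  proof -
    have "integrable (distr lborel borel ((+) c)) g" using gi lborel_distr_plus[of c] by simp
    then show "integrable lborel (\<lambda>x. g (c + x))" by (subst (asm) integrable_distr_eq) (use gm in auto)
    have "integral\<^sup>L (distr lborel borel ((+) c)) g = integral\<^sup>L lborel (\<lambda>x. g (c + x))"
      by (rule integral_distr) (use gm in auto)
    then show "integral\<^sup>L lborel (\<lambda>x. g (c + x)) = integral\<^sup>L lborel g" using lborel_distr_plus[of c] by simp
  qed
  have qi: "integral\<^sup>L lborel (q k) = 0" for k
    unfolding q_def by (simp add: tr gi Bochner_Integration.integral_diff)
  have qlim: "(\<lambda>k. q k x) \<longlonglongrightarrow> F x" for x
  proof -
    have "((\<lambda>h. (g (x + (0 + h) *\<^sub>R e) - g (x + 0 *\<^sub>R e)) / h) \<longlongrightarrow> F (x + 0 *\<^sub>R e)) (at 0)"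
      using line[of x 0] unfolding DERIV_def .
    moreover have "filterlim t (at 0) sequentially"
      unfolding filterlim_at using LIMSEQ_inverse_real_of_nat by (auto simp: t_def[abs_def])
    ultimately have "((\<lambda>k. (g (x + (0 + t k) *\<^sub>R e) - g (x + 0 *\<^sub>R e)) / t k) \<longlonglongrightarrow> F (x + 0 *\<^sub>R e))"
      by (rule filterlim_compose)
    then show ?thesis by (simp add: q_def[abs_def] add.commute)
  qed
  let ?w = "\<lambda>x. indicator (cball 0 (R + norm e)) x *\<^sub>R B"
  have dom: "integrable lborel F" "(\<lambda>k. integral\<^sup>L lborel (q k)) \<longlonglongrightarrow> integral\<^sup>L lborel F"
  proof -
    have w: "integrable lborel ?w" by (rule borel_integrable_compact) auto
    have qm: "q k \<in> borel_measurable lborel" for k unfolding q_def using gm by measurable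
    have bound: "AE x in lborel. norm (q k x) \<le> ?w x" for k
      using qB q0[of _ k] B(1) by (intro AE_I2) (auto simp: indicator_def not_le)
    show "integrable lborel F"
      by (rule integrable_dominated_convergence[where s = q, OF Fm _ w]) (use qm bound qlim in auto)
    show "(\<lambda>k. integral\<^sup>L lborel (q k)) \<longlonglongrightarrow> integral\<^sup>L lborel F"
      by (rule integral_dominated_convergence[where s = q, OF Fm _ w]) (use qm bound qlim in auto)
  qed
  then have "integral\<^sup>L lborel F = 0" by (simp add: qi LIMSEQ_const_iff)
  then have "(F has_integral 0) UNIV" using has_integral_integral_lborel[OF dom(1)] by simp
  then show ?thesis by (simp add: F_def[abs_def])
qed

text \<open>A C^1 version of max 0, rounded between 0 and \<theta>, and its derivative.\<close>

definition hinge :: "real \<Rightarrow> real \<Rightarrow> real" where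
  "hinge \<theta> z = ((max 0 z)\<^sup>2 - (max 0 (z - \<theta>))\<^sup>2) / (2 * \<theta>)"

definition hinge' :: "real \<Rightarrow> real \<Rightarrow> real" where
  "hinge' \<theta> z = (max 0 z - max 0 (z - \<theta>)) / \<theta>"

lemma DERIV_max_0_square: "((\<lambda>z::real. (max 0 z)\<^sup>2) has_real_derivative 2 * max 0 z) (at z)"
proof -
  consider "z < 0" | "z > 0" | "z = 0" by linarith
  then show ?thesis
  proof cases
    case 1
    have "((\<lambda>z::real. 0) has_real_derivative 0) (at z)" by simp
    then have "((\<lambda>z::real. (max 0 z)\<^sup>2) has_real_derivative 0) (at z)"
      by (rule has_field_derivative_transform_within_open[of _ _ _ "{..<0}"]) (use 1 in auto)
    then show ?thesis using 1 by simp
  next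
    case 2
    have "((\<lambda>z::real. z\<^sup>2) has_real_derivative 2 * z) (at z)" by (auto intro!: derivative_eq_intros)
    then have "((\<lambda>z::real. (max 0 z)\<^sup>2) has_real_derivative 2 * z) (at z)"
      by (rule has_field_derivative_transform_within_open[of _ _ _ "{0<..}"]) (use 2 in auto)
    then show ?thesis using 2 by simp
  next
    case 3
    have "((\<lambda>h::real. (max 0 h)\<^sup>2 / h) \<longlongrightarrow> 0) (at 0)"
    proof (rule Lim_null_comparison)
      show "\<forall>\<^sub>F h in at 0. norm ((max 0 h)\<^sup>2 / h) \<le> \<bar>h\<bar>"
        by (auto simp: max_def power2_eq_square)
      show "((\<lambda>h::real. \<bar>h\<bar>) \<longlongrightarrow> 0) (at 0)" by (auto intro!: tendsto_eq_intros)
    qed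
    then show ?thesis unfolding DERIV_def 3 by simp
  qed
qed

text \<open>The slope climbs linearly from 0 to 1 on [0,\<theta>], so the straight part lags
  \<theta> / 2 behind z. The bounds by max 0 z and z - \<theta> / 2 control profiles assembled from
  several hinges.\<close>

lemma hinge_props:
  assumes "0 < \<theta>"
  shows DERIV_hinge: "\<And>z. (hinge \<theta> has_real_derivative hinge' \<theta> z) (at z)"
    and continuous_hinge': "continuous_on UNIV (hinge' \<theta>)"
    and hinge'_nonneg: "\<And>z. 0 \<le> hinge' \<theta> z" and hinge'_le_1: "\<And>z. hinge' \<theta> z \<le> 1"
    and hinge'_mono: "\<And>y z. y \<le> z \<Longrightarrow> hinge' \<theta> y \<le> hinge' \<theta> z"
    and hinge'_0: "\<And>z. z \<le> 0 \<Longrightarrow> hinge' \<theta> z = 0" and hinge'_1: "\<And>z. \<theta> \<le> z \<Longrightarrow> hinge' \<theta> z = 1"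
    and hinge_0: "\<And>z. z \<le> 0 \<Longrightarrow> hinge \<theta> z = 0" and hinge_linear: "\<And>z. \<theta> \<le> z \<Longrightarrow> hinge \<theta> z = z - \<theta> / 2"
    and hinge_nonneg: "\<And>z. 0 \<le> hinge \<theta> z"
    and hinge_le: "\<And>z. hinge \<theta> z \<le> max 0 z" and hinge_ge: "\<And>z. z - \<theta> / 2 \<le> hinge \<theta> z"
proof -
  show D: "(hinge \<theta> has_real_derivative hinge' \<theta> z) (at z)" for z
  proof -
    have "((\<lambda>z. (max 0 (z - \<theta>))\<^sup>2) has_real_derivative 2 * max 0 (z - \<theta>)) (at z)"
    proof -
      have "((\<lambda>z. z - \<theta>) has_real_derivative 1) (at z)" by (auto intro!: derivative_eq_intros)
      from DERIV_chain2[OF DERIV_max_0_square this] show ?thesis by simp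
    qed
    then have "(hinge \<theta> has_real_derivative (2 * max 0 z - 2 * max 0 (z - \<theta>)) / (2 * \<theta>)) (at z)"
      unfolding hinge_def[abs_def] by (intro DERIV_cdivide DERIV_diff DERIV_max_0_square)
    moreover have "(2 * max 0 z - 2 * max 0 (z - \<theta>)) / (2 * \<theta>) = hinge' \<theta> z"
      unfolding hinge'_def using assms by (simp add: field_simps)
    ultimately show ?thesis by simp
  qed
  show "continuous_on UNIV (hinge' \<theta>)" unfolding hinge'_def[abs_def] by (intro continuous_intros) (use assms in auto)
  show "0 \<le> hinge' \<theta> z" "hinge' \<theta> z \<le> 1" "z \<le> 0 \<Longrightarrow> hinge' \<theta> z = 0" "\<theta> \<le> z \<Longrightarrow> hinge' \<theta> z = 1" for z
    using assms by (auto simp: hinge'_def max_def divide_simps)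
  show "hinge' \<theta> y \<le> hinge' \<theta> z" if "y \<le> z" for y z
    unfolding hinge'_def using assms that by (intro divide_right_mono) (auto simp: max_def)
  show h0: "hinge \<theta> z = 0" if "z \<le> 0" for z using that assms by (auto simp: hinge_def max_def)
  show h1: "hinge \<theta> z = z - \<theta> / 2" if "\<theta> \<le> z" for z
    using that assms by (auto simp: hinge_def max_def power2_eq_square field_simps)
  have h2: "hinge \<theta> z = z * z / (2 * \<theta>)" if "0 \<le> z" "z \<le> \<theta>" for z
    using that assms by (auto simp: hinge_def max_def power2_eq_square)
  have *: "0 \<le> hinge \<theta> z \<and> hinge \<theta> z \<le> max 0 z \<and> z - \<theta> / 2 \<le> hinge \<theta> z" for z
  proof -
    consider "z \<le> 0" | "0 < z" "z < \<theta>" | "\<theta> \<le> z" by linarith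
    then show ?thesis
    proof cases
      case 2
      have "z * z \<le> z * (2 * \<theta>)" using 2 by (intro mult_left_mono) auto
      moreover have "(z - \<theta> / 2) * (2 * \<theta>) \<le> z * z" using zero_le_square[of "z - \<theta>"] by (simp add: algebra_simps)
      ultimately show ?thesis
        using 2 h2[of z] assms by (simp add: pos_le_divide_eq pos_divide_le_eq)
    qed (use h0 h1 assms in auto)
  qed
  then show "0 \<le> hinge \<theta> z" "hinge \<theta> z \<le> max 0 z" "z - \<theta> / 2 \<le> hinge \<theta> z" for z by auto
qed

section \<open>Test fields and the perimeter as their supremum\<close>

definition test_field :: "('a::euclidean_space \<Rightarrow> 'a) \<Rightarrow> ('a \<Rightarrow> 'a \<Rightarrow>\<^sub>L 'a) \<Rightarrow> bool" where
  "test_field \<phi> \<phi>' \<longleftrightarrow> (\<forall>x. (\<phi> has_derivative blinfun_apply (\<phi>' x)) (at x)) \<and> continuous_on UNIV \<phi>' \<and>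
      compact (closure {x. \<phi> x \<noteq> 0}) \<and> (\<forall>x. norm (\<phi> x) \<le> 1)"

definition divergence :: "('a::euclidean_space \<Rightarrow> 'a \<Rightarrow>\<^sub>L 'a) \<Rightarrow> 'a \<Rightarrow> real" where
  "divergence \<phi>' x = (\<Sum>i\<in>Basis. blinfun_apply (\<phi>' x) i \<bullet> i)"

lemma perimeter_alt: "perimeter S = Sup {integral S (divergence \<phi>') | \<phi> \<phi>'. test_field \<phi> \<phi>'}"
  unfolding perimeter_def test_field_def divergence_def[abs_def] by simp

lemma test_field_0: "test_field (\<lambda>_. 0) (\<lambda>_. 0)"
  by (auto simp: test_field_def zero_blinfun.rep_eq)

lemma continuous_divergence: "test_field \<phi> \<phi>' \<Longrightarrow> continuous_on UNIV (divergence \<phi>')"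
  unfolding test_field_def divergence_def[abs_def] by (intro continuous_intros) auto

lemma divergence_bounded:
  assumes "test_field \<phi> \<phi>'" "bounded S"
  obtains M where "0 \<le> M" "\<And>x. x \<in> S \<Longrightarrow> \<bar>divergence \<phi>' x\<bar> \<le> M"
proof -
  have "bounded (divergence \<phi>' ` closure S)"
    using assms by (intro compact_imp_bounded compact_continuous_image continuous_on_subset[OF continuous_divergence])
      (auto simp: compact_closure)
  then obtain M where "0 < M" "\<And>x. x \<in> closure S \<Longrightarrow> \<bar>divergence \<phi>' x\<bar> \<le> M" by (auto simp: bounded_pos)
  then show thesis using that[of M] closure_subset by (auto simp: less_imp_le subset_iff)
qed

lemma continuous_integrable_on_open:
  fixes f :: "'a::euclidean_space \<Rightarrow> real"
  assumes "continuous_on UNIV f" "open S" "bounded S"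
  shows "f absolutely_integrable_on S"
proof -
  obtain a where a: "S \<subseteq> cbox (- a) a" using bounded_subset_cbox_symmetric[OF assms(3)] by auto
  have "f absolutely_integrable_on cbox (- a) a"
    by (intro absolutely_integrable_continuous continuous_on_subset[OF assms(1)]) auto
  then show ?thesis by (rule set_integrable_subset) (use a assms(2) in auto)
qed

text \<open>The strict inequality makes the set open, as Brunn--Minkowski for open sets
  requires.\<close>

definition inner_parallel :: "'a::euclidean_space set \<Rightarrow> real \<Rightarrow> 'a set" where
  "inner_parallel S t = {x \<in> S. t < dist_bd S x}"

lemma continuous_dist_bd: "continuous_on UNIV (dist_bd S)"
  unfolding dist_bd_def[abs_def] by (intro continuous_intros)

context bounded_convex_open
begin

lemma inner_parallel_open: "open (inner_parallel \<Omega> t)"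
proof -
  have "inner_parallel \<Omega> t = \<Omega> \<inter> {x. t < dist_bd \<Omega> x}" by (auto simp: inner_parallel_def)
  then show ?thesis using opn by (auto intro!: open_Int open_Collect_less continuous_dist_bd)
qed

lemma inner_parallel_subset: "inner_parallel \<Omega> t \<subseteq> \<Omega>"
  by (auto simp: inner_parallel_def)

lemma inner_parallel_bounded: "bounded (inner_parallel \<Omega> t)"
  using bnd inner_parallel_subset bounded_subset by blast

lemma lmeasurable_\<Omega>: "\<Omega> \<in> lmeasurable" "inner_parallel \<Omega> t \<in> lmeasurable"
  using bnd opn inner_parallel_open inner_parallel_bounded by (auto intro: lmeasurable_open)

lemma measure_collar: "vol (\<Omega> - inner_parallel \<Omega> t) = vol \<Omega> - vol (inner_parallel \<Omega> t)"
  by (rule measurable_measure_Diff) (use lmeasurable_\<Omega> inner_parallel_subset in \<open>auto intro: fmeasurableD\<close>)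

lemma has_integral_collar:
  "((\<lambda>x. c * indicator (\<Omega> - inner_parallel \<Omega> t) x) has_integral c * (vol \<Omega> - vol (inner_parallel \<Omega> t))) \<Omega>"
proof -
  have m: "\<Omega> - inner_parallel \<Omega> t \<in> lmeasurable" by (intro fmeasurable_Diff lmeasurable_\<Omega> fmeasurableD)
  have "(indicator (\<Omega> - inner_parallel \<Omega> t) has_integral vol (\<Omega> - inner_parallel \<Omega> t)) UNIV"
    using has_integral_measure_lborel m
    by (metis lmeasurable_iff_has_integral lmeasure_integral_UNIV integral_unique)
  then have *: "((\<lambda>x. c * indicator (\<Omega> - inner_parallel \<Omega> t) x) has_integral c * vol (\<Omega> - inner_parallel \<Omega> t)) UNIV"
    by (rule has_integral_mult_right)
  have "((\<lambda>x. if x \<in> \<Omega> then c * indicator (\<Omega> - inner_parallel \<Omega> t) x else 0)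
      has_integral c * vol (\<Omega> - inner_parallel \<Omega> t)) UNIV"
    by (rule has_integral_eq[OF _ *]) (auto simp: indicator_def)
  then show ?thesis unfolding measure_collar[symmetric] by (simp only: has_integral_restrict_UNIV)
qed

text \<open>For a cutoff \<psi> that is 0 outside \<Omega> and 1 at depth beyond \<epsilon>', the
  divergence of \<psi> \<phi> integrates to 0. What remains is the integral of (1 - \<psi>) div
  \<phi> + c (n \<bullet> \<phi>), where - c n is the gradient of \<psi>. Both terms live in the
  collar, with bounds \<open>M\<close> and 1 / \<epsilon>.\<close>

lemma test_field_integral_le:
  assumes \<phi>: "test_field \<phi> \<phi>'" and M: "0 \<le> M" "\<And>x. x \<in> \<Omega> \<Longrightarrow> \<bar>divergence \<phi>' x\<bar> \<le> M"
    and \<epsilon>: "0 < \<epsilon>" "\<epsilon> < \<epsilon>'"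
  shows "integral \<Omega> (divergence \<phi>') \<le> (M + 1 / \<epsilon>) * (vol \<Omega> - vol (inner_parallel \<Omega> \<epsilon>'))"
proof -
  \<comment> \<open>The error of u, the shift in \<open>z\<close> and the rounding of the hinge cost
    one \<theta> each out of the four available.\<close>
  define \<theta> where "\<theta> = (\<epsilon>' - \<epsilon>) / 4"
  have \<theta>: "0 < \<theta>" "\<epsilon>' = \<epsilon> + 4 * \<theta>" using \<epsilon> by (auto simp: \<theta>_def field_simps)
  obtain u n n' \<kappa> where u: "\<forall>x\<in>\<Omega>. \<bar>u x + dist_bd \<Omega> x\<bar> \<le> \<theta>" "\<forall>x. x \<notin> \<Omega> \<longrightarrow> - \<theta> \<le> u x"
    "\<forall>c. bounded {x. u x \<le> c}"
    "\<forall>x. (u has_derivative (\<lambda>v. n x \<bullet> v)) (at x)" "\<forall>x. (n has_derivative n' x) (at x)"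
    "\<forall>v. continuous_on UNIV (\<lambda>x. n' x v)" "\<forall>x. norm (n x) \<le> 1"
    "\<forall>x. (\<Sum>i\<in>Basis. n' x i \<bullet> i) = \<kappa> * (1 - (norm (n x))\<^sup>2)" "2 / \<theta> \<le> \<kappa>"
    by (rule smooth_signed_distance[OF \<theta>(1)])
  note h = hinge_props[OF \<theta>(1)]
  define z where "z x = - u x - \<theta>" for x
  \<comment> \<open>A ramp in depth: the difference of two hinges at distance \<epsilon> rises to
    exactly \<epsilon> with slope at most 1. The shift by \<theta> in \<open>z\<close> makes both
    hinges vanish outside \<Omega>.\<close>
  define \<psi> where "\<psi> x = (hinge \<theta> (z x) - hinge \<theta> (z x - \<epsilon>)) / \<epsilon>" for x
  define c where "c x = (hinge' \<theta> (z x) - hinge' \<theta> (z x - \<epsilon>)) / \<epsilon>" for x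
  have cu: "continuous_on UNIV u" and cn: "continuous_on UNIV n"
    using u(4,5) by (meson continuous_at_imp_continuous_on has_derivative_continuous)+
  have cz: "continuous_on UNIV z" unfolding z_def[abs_def] by (intro continuous_intros cu)
  have zd: "(z has_derivative (\<lambda>v. - (n x \<bullet> v))) (at x)" for x
    unfolding z_def[abs_def] using u(4) by (auto intro!: derivative_eq_intros)
  have hz: "((\<lambda>x. hinge \<theta> (z x - a)) has_derivative (\<lambda>v. hinge' \<theta> (z x - a) * (- (n x \<bullet> v)))) (at x)" for a x
  proof -
    have "((\<lambda>x. z x - a) has_derivative (\<lambda>v. - (n x \<bullet> v))) (at x)"
      by (rule has_derivative_eq_rhs, rule has_derivative_diff[OF zd has_derivative_const]) auto
    from has_derivative_compose[OF this DERIV_hinge[OF \<theta>(1), THEN has_field_derivative_imp_has_derivative]]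
    show ?thesis by simp
  qed
  have \<psi>d: "(\<psi> has_derivative (\<lambda>v. - c x * (n x \<bullet> v))) (at x)" for x
  proof -
    have "(\<psi> has_derivative (\<lambda>v. (hinge' \<theta> (z x - 0) * (- (n x \<bullet> v)) - hinge' \<theta> (z x - \<epsilon>) * (- (n x \<bullet> v))) / \<epsilon>)) (at x)"
      unfolding \<psi>_def[abs_def] using hz[of 0 x] hz[of \<epsilon> x] \<epsilon>(1) by (auto intro!: derivative_eq_intros)
    then show ?thesis by (rule has_derivative_eq_rhs) (auto simp: c_def algebra_simps diff_divide_distrib)
  qed
  have cc: "continuous_on UNIV c"
    unfolding c_def[abs_def] using \<epsilon>
    by (intro continuous_intros continuous_on_compose2[OF continuous_hinge'[OF \<theta>(1)]] cz) auto
  have c\<psi>: "continuous_on UNIV \<psi>" using \<psi>d by (meson continuous_at_imp_continuous_on has_derivative_continuous)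
  have outside: "\<psi> x = 0" "c x = 0" if "x \<notin> \<Omega>" for x
  proof -
    have "z x \<le> 0" using u(2) that by (auto simp: z_def)
    then show "\<psi> x = 0" "c x = 0" using \<epsilon> by (auto simp: \<psi>_def c_def h)
  qed
  have inside: "\<psi> x = 1" "c x = 0" if "x \<in> inner_parallel \<Omega> \<epsilon>'" for x
  proof -
    have "\<epsilon>' < dist_bd \<Omega> x" "\<bar>u x + dist_bd \<Omega> x\<bar> \<le> \<theta>" using that u(1) by (auto simp: inner_parallel_def)
    then have "\<theta> \<le> z x - \<epsilon>" unfolding z_def \<theta>(2) using \<theta>(1) by linarith
    then show "\<psi> x = 1" "c x = 0" using \<epsilon> by (auto simp: \<psi>_def c_def h)
  qed
  have crange: "0 \<le> c x" "c x \<le> 1 / \<epsilon>" for x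
    using h(3)[of "z x - \<epsilon>"] h(4)[of "z x"] h(5)[of "z x - \<epsilon>" "z x"] \<epsilon>(1)
    by (auto simp: c_def intro!: divide_right_mono)
  have \<psi>range: "0 \<le> \<psi> x" "\<psi> x \<le> 1" for x
  proof -
    have mono: "hinge \<theta> a \<le> hinge \<theta> b" if "a \<le> b" for a b
      by (rule DERIV_nonneg_imp_nondecreasing[OF that]) (use h(1,3) in blast)
    show "0 \<le> \<psi> x" using mono[of "z x - \<epsilon>" "z x"] \<epsilon>(1) by (simp add: \<psi>_def)
    obtain \<xi> where "hinge \<theta> (z x) - hinge \<theta> (z x - \<epsilon>) = (z x - (z x - \<epsilon>)) * hinge' \<theta> \<xi>"
      using MVT2[of "z x - \<epsilon>" "z x" "hinge \<theta>" "hinge' \<theta>"] h(1) \<epsilon>(1) by auto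
    then show "\<psi> x \<le> 1" using h(4)[of \<xi>] \<epsilon>(1) by (simp add: \<psi>_def)
  qed
  have \<phi>d: "(\<phi> has_derivative blinfun_apply (\<phi>' x)) (at x)" and n\<phi>: "norm (\<phi> x) \<le> 1" for x
    using \<phi> by (auto simp: test_field_def)
  have c\<phi>': "continuous_on UNIV \<phi>'" using \<phi> by (auto simp: test_field_def)
  have c\<phi>: "continuous_on UNIV \<phi>" using \<phi>d by (meson continuous_at_imp_continuous_on has_derivative_continuous)
  have "((\<lambda>x. \<psi> x * (blinfun_apply (\<phi>' x) i \<bullet> i) + (- c x * (n x \<bullet> i)) * (\<phi> x \<bullet> i)) has_integral 0) UNIV" for i
  proof (rule integral_directional_derivative_zero[where g = "\<lambda>x. \<psi> x * (\<phi> x \<bullet> i)"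
        and g' = "\<lambda>x v. \<psi> x * (blinfun_apply (\<phi>' x) v \<bullet> i) + (- c x * (n x \<bullet> v)) * (\<phi> x \<bullet> i)" and e = i])
    show "((\<lambda>x. \<psi> x * (\<phi> x \<bullet> i)) has_derivative
      (\<lambda>v. \<psi> x * (blinfun_apply (\<phi>' x) v \<bullet> i) + (- c x * (n x \<bullet> v)) * (\<phi> x \<bullet> i))) (at x)" for x
      by (intro has_derivative_mult \<psi>d has_derivative_inner_left \<phi>d)
    show "continuous_on UNIV (\<lambda>x. \<psi> x * (blinfun_apply (\<phi>' x) i \<bullet> i) + (- c x * (n x \<bullet> i)) * (\<phi> x \<bullet> i))"
      by (intro continuous_intros c\<psi> c\<phi>' cc cn c\<phi>)
    have "bounded {x. \<phi> x \<noteq> 0}"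
      using \<phi> bounded_subset[OF compact_imp_bounded closure_subset] by (auto simp: test_field_def)
    then show "bounded {x. \<psi> x * (\<phi> x \<bullet> i) \<noteq> 0}" by (rule bounded_subset) auto
  qed
  then have "((\<lambda>x. \<Sum>i\<in>Basis. \<psi> x * (blinfun_apply (\<phi>' x) i \<bullet> i) + (- c x * (n x \<bullet> i)) * (\<phi> x \<bullet> i)) has_integral (\<Sum>i\<in>(Basis::'a set). 0)) UNIV"
    by (intro has_integral_sum) auto
  moreover have "(\<Sum>i\<in>Basis. \<psi> x * (blinfun_apply (\<phi>' x) i \<bullet> i) + (- c x * (n x \<bullet> i)) * (\<phi> x \<bullet> i))
    = \<psi> x * divergence \<phi>' x - c x * (n x \<bullet> \<phi> x)" for x
    by (simp add: sum_subtractf divergence_def sum_distrib_left euclidean_inner[of "n x" "\<phi> x"] mult_ac)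
  ultimately have \<Psi>: "((\<lambda>x. \<psi> x * divergence \<phi>' x - c x * (n x \<bullet> \<phi> x)) has_integral 0) UNIV" by simp
  have "((\<lambda>x. if x \<in> \<Omega> then \<psi> x * divergence \<phi>' x - c x * (n x \<bullet> \<phi> x) else 0) has_integral 0) UNIV"
    by (rule has_integral_eq[OF _ \<Psi>]) (use outside in auto)
  then have \<Psi>\<Omega>: "((\<lambda>x. \<psi> x * divergence \<phi>' x - c x * (n x \<bullet> \<phi> x)) has_integral 0) \<Omega>"
    by (simp only: has_integral_restrict_UNIV)
  have "divergence \<phi>' integrable_on \<Omega>"
    using continuous_integrable_on_open[OF continuous_divergence[OF \<phi>] opn bnd] set_lebesgue_integral_eq_integral(1) by blast
  then have "(divergence \<phi>' has_integral integral \<Omega> (divergence \<phi>')) \<Omega>" by (rule integrable_integral)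
  from has_integral_diff[OF this \<Psi>\<Omega>]
  have I: "((\<lambda>x. divergence \<phi>' x - (\<psi> x * divergence \<phi>' x - c x * (n x \<bullet> \<phi> x))) has_integral integral \<Omega> (divergence \<phi>')) \<Omega>" by simp
  show ?thesis
  proof (rule has_integral_le[OF I has_integral_collar])
    fix x assume x: "x \<in> \<Omega>"
    show "divergence \<phi>' x - (\<psi> x * divergence \<phi>' x - c x * (n x \<bullet> \<phi> x)) \<le> (M + 1 / \<epsilon>) * indicator (\<Omega> - inner_parallel \<Omega> \<epsilon>') x"
    proof (cases "x \<in> inner_parallel \<Omega> \<epsilon>'")
      case True
      then show ?thesis using inside by simp
    next
      case False
      have "(1 - \<psi> x) * divergence \<phi>' x \<le> 1 * M"
      proof -
        have "(1 - \<psi> x) * divergence \<phi>' x \<le> (1 - \<psi> x) * M"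
          using \<psi>range[of x] M(2)[OF x] by (intro mult_left_mono) auto
        also have "\<dots> \<le> 1 * M" using \<psi>range[of x] M(1) by (intro mult_right_mono) auto
        finally show ?thesis .
      qed
      moreover have "c x * (n x \<bullet> \<phi> x) \<le> 1 / \<epsilon> * 1"
      proof -
        have "n x \<bullet> \<phi> x \<le> norm (n x) * norm (\<phi> x)" by (rule norm_cauchy_schwarz)
        also have "\<dots> \<le> 1 * 1" using u(7) n\<phi>[of x] by (intro mult_mono) auto
        finally have "c x * (n x \<bullet> \<phi> x) \<le> c x * 1" using crange(1) by (intro mult_left_mono) auto
        then show ?thesis using crange(2)[of x] by simp
      qed
      ultimately show ?thesis using x False by (simp add: algebra_simps)
    qed
  qed
qed

end

section \<open>From collar growth to bounds on the perimeter\<close>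

lemma measure_affine_image:
  fixes S :: "'a::euclidean_space set"
  shows "measure lebesgue ((\<lambda>x. c *\<^sub>R x + b) ` S) = \<bar>c\<bar> ^ DIM('a) * measure lebesgue S"
  using measure_lebesgue_affine[of c b S] by simp

context bounded_convex_open
begin

text \<open>With transition width \<epsilon> and collar width \<epsilon> + \<epsilon>^2 the estimate
  becomes (M \<epsilon> + 1) C (1 + \<epsilon>). The quadratic margin gives the strict inequality
  between the widths, yet it disappears in the limit together with the bound on the
  divergence.\<close>

lemma test_field_integral_le_growth:
  assumes \<phi>: "test_field \<phi> \<phi>'" and e0: "0 < e0"
    and growth: "\<And>\<epsilon>. 0 < \<epsilon> \<Longrightarrow> \<epsilon> < e0 \<Longrightarrow> vol \<Omega> - vol (inner_parallel \<Omega> \<epsilon>) \<le> C * \<epsilon>"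
  shows "integral \<Omega> (divergence \<phi>') \<le> C"
proof -
  obtain M where M: "0 \<le> M" "\<And>x. x \<in> \<Omega> \<Longrightarrow> \<bar>divergence \<phi>' x\<bar> \<le> M"
    using divergence_bounded[OF \<phi> bnd] by blast
  have le: "integral \<Omega> (divergence \<phi>') \<le> (M * \<epsilon> + 1) * (C * (1 + \<epsilon>))" if \<epsilon>: "0 < \<epsilon>" "\<epsilon> < min 1 (e0 / 2)" for \<epsilon>
  proof -
    have "\<epsilon> * \<epsilon> < 1 * \<epsilon>" using \<epsilon> by (intro mult_strict_right_mono) auto
    moreover have "0 < \<epsilon> * \<epsilon>" using \<epsilon> by simp
    ultimately have e2: "0 < \<epsilon> + \<epsilon> * \<epsilon>" "\<epsilon> + \<epsilon> * \<epsilon> < e0" "\<epsilon> < \<epsilon> + \<epsilon> * \<epsilon>"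
      using \<epsilon> unfolding min_less_iff_conj by linarith+
    have "integral \<Omega> (divergence \<phi>') \<le> (M + 1 / \<epsilon>) * (vol \<Omega> - vol (inner_parallel \<Omega> (\<epsilon> + \<epsilon> * \<epsilon>)))"
      by (rule test_field_integral_le[OF \<phi> M \<epsilon>(1) e2(3)])
    also have "\<dots> \<le> (M + 1 / \<epsilon>) * (C * (\<epsilon> + \<epsilon> * \<epsilon>))"
      using growth[OF e2(1,2)] M(1) \<epsilon>(1) by (intro mult_left_mono) auto
    also have "\<dots> = (M * \<epsilon> + 1) * (C * (1 + \<epsilon>))" using \<epsilon>(1) by (simp add: field_simps)
    finally show ?thesis .
  qed
  have "((\<lambda>\<epsilon>. (M * \<epsilon> + 1) * (C * (1 + \<epsilon>))) \<longlongrightarrow> (M * 0 + 1) * (C * (1 + 0))) (at_right 0)"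
    by (intro tendsto_intros)
  moreover have "eventually (\<lambda>\<epsilon>. 0 < \<epsilon> \<and> \<epsilon> < min 1 (e0 / 2)) (at_right (0::real))"
    using e0 by (auto simp: eventually_at_right_less eventually_at_right_field intro!: eventually_conj exI[of _ "min 1 (e0 / 2)"])
  ultimately have "integral \<Omega> (divergence \<phi>') \<le> (M * 0 + 1) * (C * (1 + 0))"
    by (intro tendsto_lowerbound[where F = "at_right 0"]) (auto elim!: eventually_mono intro: le)
  then show ?thesis by simp
qed

text \<open>Contracting \<Omega> towards x0 by the factor 1 - t / \<rho> moves every point to depth
  above t, by concavity of the distance. One fixed ball yields finiteness of the perimeter; balls
  close to the inradius yield the equality case.\<close>

lemma inner_parallel_homothety:
  assumes "ball x0 \<rho> \<subseteq> \<Omega>" "0 \<le> t" "t < \<rho>"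
  shows "(1 - t / \<rho>) ^ DIM('a) * vol \<Omega> \<le> vol (inner_parallel \<Omega> t)"
proof -
  define s where "s = t / \<rho>"
  have s: "0 \<le> s" "s < 1" "s * \<rho> = t" using assms by (auto simp: s_def)
  have x0: "x0 \<in> \<Omega>" "\<rho> \<le> dist_bd \<Omega> x0" using assms le_dist_bd by auto
  have "(\<lambda>x. (1 - s) *\<^sub>R x + s *\<^sub>R x0) ` \<Omega> \<subseteq> inner_parallel \<Omega> t"
  proof safe
    fix x assume x: "x \<in> \<Omega>"
    have "t = s * \<rho>" using s by simp
    also have "\<dots> \<le> s * dist_bd \<Omega> x0" using s x0 by (intro mult_left_mono)
    also have "\<dots> < (1 - s) * dist_bd \<Omega> x + s * dist_bd \<Omega> x0" using s dist_bd_pos[OF x] by simp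
    also have "\<dots> \<le> dist_bd \<Omega> ((1 - s) *\<^sub>R x + s *\<^sub>R x0)" using s x x0 by (intro dist_bd_concave) auto
    finally show "(1 - s) *\<^sub>R x + s *\<^sub>R x0 \<in> inner_parallel \<Omega> t"
      using convexD_alt[OF conv x x0(1), of s] s by (auto simp: inner_parallel_def)
  qed
  moreover have "(\<lambda>x. (1 - s) *\<^sub>R x + s *\<^sub>R x0) ` \<Omega> \<in> sets lebesgue"
    using open_affinity[OF opn, of "1 - s" "s *\<^sub>R x0"] s by (auto simp: add.commute image_image)
  ultimately have "measure lebesgue ((\<lambda>x. (1 - s) *\<^sub>R x + s *\<^sub>R x0) ` \<Omega>) \<le> vol (inner_parallel \<Omega> t)"
    by (intro measure_mono_fmeasurable lmeasurable_\<Omega>)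
  then show ?thesis using s by (simp add: measure_affine_image s_def)
qed

lemma collar_growth_exists: "\<exists>C e0. 0 < e0 \<and> (\<forall>\<epsilon>. 0 < \<epsilon> \<longrightarrow> \<epsilon> < e0 \<longrightarrow> vol \<Omega> - vol (inner_parallel \<Omega> \<epsilon>) \<le> C * \<epsilon>)"
proof -
  obtain x0 where x0: "x0 \<in> \<Omega>" using ne by auto
  let ?\<rho> = "dist_bd \<Omega> x0"
  have \<rho>: "0 < ?\<rho>" "ball x0 ?\<rho> \<subseteq> \<Omega>" using dist_bd_pos ball_dist_bd x0 by auto
  have "vol \<Omega> - vol (inner_parallel \<Omega> \<epsilon>) \<le> (DIM('a) * vol \<Omega> / ?\<rho>) * \<epsilon>" if "0 < \<epsilon>" "\<epsilon> < ?\<rho>" for \<epsilon>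
  proof -
    have "1 + DIM('a) * (- (\<epsilon> / ?\<rho>)) \<le> (1 + (- (\<epsilon> / ?\<rho>))) ^ DIM('a)"
      using that by (intro Bernoulli_inequality) auto
    then have "(1 - DIM('a) * (\<epsilon> / ?\<rho>)) * vol \<Omega> \<le> (1 - \<epsilon> / ?\<rho>) ^ DIM('a) * vol \<Omega>"
      by (intro mult_right_mono) auto
    then show ?thesis using inner_parallel_homothety[OF \<rho>(2), of \<epsilon>] that by (simp add: algebra_simps)
  qed
  then show ?thesis using \<rho>(1) by blast
qed

text \<open>A real supremum carries information only for a set bounded above, so finiteness has to
  precede every comparison of a field with the perimeter. Any inscribed ball provides it.\<close>

lemma bdd_above_perimeter: "bdd_above {integral \<Omega> (divergence \<phi>') | \<phi> \<phi>'. test_field \<phi> \<phi>'}"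
proof -
  obtain C e0 where "0 < e0" "\<And>\<epsilon>. 0 < \<epsilon> \<Longrightarrow> \<epsilon> < e0 \<Longrightarrow> vol \<Omega> - vol (inner_parallel \<Omega> \<epsilon>) \<le> C * \<epsilon>"
    using collar_growth_exists by blast
  from test_field_integral_le_growth[OF _ this] show ?thesis by (auto intro!: bdd_aboveI[of _ C])
qed

lemma perimeter_ge: "test_field \<phi> \<phi>' \<Longrightarrow> integral \<Omega> (divergence \<phi>') \<le> perimeter \<Omega>"
  unfolding perimeter_alt by (rule cSup_upper[OF _ bdd_above_perimeter]) auto

text \<open>The source of all upper bounds on the perimeter. The zero field makes the supremum range
  over a nonempty set.\<close>

lemma perimeter_le:
  assumes "0 < e0" "\<And>\<epsilon>. 0 < \<epsilon> \<Longrightarrow> \<epsilon> < e0 \<Longrightarrow> vol \<Omega> - vol (inner_parallel \<Omega> \<epsilon>) \<le> C * \<epsilon>"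
  shows "perimeter \<Omega> \<le> C"
  unfolding perimeter_alt
  by (rule cSup_least) (use test_field_0 test_field_integral_le_growth[OF _ assms] in auto)

text \<open>For the field w(u) n the divergence is q w' + (1 - q) \<kappa> w with q = |n|^2. On the
  collar w' = 1/t and \<kappa> w \<ge> 1/t; in the rest of \<Omega> both are nonnegative. So the
  integral is at least the collar volume divided by t, where t exceeds \<tau> by a vanishing
  error.\<close>

lemma collar_le_perimeter_aux:
  assumes \<tau>: "0 < \<tau>" and \<theta>: "0 < \<theta>"
  shows "vol \<Omega> - vol (inner_parallel \<Omega> \<tau>) \<le> perimeter \<Omega> * (\<tau> + 4 * \<theta>)"
proof -
  obtain u n n' \<kappa> where u: "\<forall>x\<in>\<Omega>. \<bar>u x + dist_bd \<Omega> x\<bar> \<le> \<theta>" "\<forall>x. x \<notin> \<Omega> \<longrightarrow> - \<theta> \<le> u x"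
    "\<forall>c. bounded {x. u x \<le> c}"
    "\<forall>x. (u has_derivative (\<lambda>v. n x \<bullet> v)) (at x)" "\<forall>x. (n has_derivative n' x) (at x)"
    "\<forall>v. continuous_on UNIV (\<lambda>x. n' x v)" "\<forall>x. norm (n x) \<le> 1"
    "\<forall>x. (\<Sum>i\<in>Basis. n' x i \<bullet> i) = \<kappa> * (1 - (norm (n x))\<^sup>2)" "2 / \<theta> \<le> \<kappa>"
    by (rule smooth_signed_distance[OF \<theta>])
  note h = hinge_props[OF \<theta>]
  \<comment> \<open>The unrounded tent below has height \<tau> + 3 \<theta>; the lag \<theta> / 2 of
    its doubled hinge adds one more \<theta>. Division by t therefore keeps the profile within norm
    1.\<close>
  define t where "t = \<tau> + 4 * \<theta>"
  have t: "0 < t" using \<tau> \<theta> by (simp add: t_def)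
  have \<kappa>: "0 < \<kappa>" using u(9) \<theta> by (meson divide_pos_pos less_le_trans zero_less_numeral)
  \<comment> \<open>On the collar u \<ge> - \<tau> - \<theta>; starting \<theta> earlier puts the
    collar on the straight part of the first hinge.\<close>
  define a where "a = - \<tau> - 2 * \<theta>"
  \<comment> \<open>A rounded tent: ascent from \<open>a\<close>, peak near \<theta>, symmetric
    descent. Since u \<le> \<theta> on \<Omega>, only the ascent is seen there; the descent provides
    compact support.\<close>
  define w where "w s = (hinge \<theta> (s - a) - 2 * hinge \<theta> (s - \<theta>) + hinge \<theta> (s - 2 * \<theta> + a)) / t" for s
  define w' where "w' s = (hinge' \<theta> (s - a) - 2 * hinge' \<theta> (s - \<theta>) + hinge' \<theta> (s - 2 * \<theta> + a)) / t" for s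
  have hd: "((\<lambda>s. hinge \<theta> (s - b)) has_real_derivative hinge' \<theta> (s - b)) (at s)" for b s
  proof -
    have "((\<lambda>s. s - b) has_real_derivative 1) (at s)" by (auto intro!: derivative_eq_intros)
    from DERIV_chain2[OF h(1) this] show ?thesis by simp
  qed
  have wd: "(w has_real_derivative w' s) (at s)" for s
  proof -
    have "((\<lambda>s. hinge \<theta> (s - 2 * \<theta> + a)) has_real_derivative hinge' \<theta> (s - 2 * \<theta> + a)) (at s)"
      using hd[of "2 * \<theta> - a" s] by (simp add: algebra_simps)
    then show ?thesis unfolding w_def[abs_def] w'_def
      by (intro DERIV_cdivide DERIV_add DERIV_diff DERIV_cmult hd)
  qed
  have cw': "continuous_on UNIV w'"
    unfolding w'_def[abs_def] using t
    by (intro continuous_intros continuous_on_compose2[OF continuous_hinge'[OF \<theta>]]) auto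
  have cw: "continuous_on UNIV w" using wd by (meson DERIV_continuous continuous_at_imp_continuous_on)
  have cu: "continuous_on UNIV u" and cn: "continuous_on UNIV n"
    using u(4,5) by (meson continuous_at_imp_continuous_on has_derivative_continuous)+
  have w_bound: "\<bar>w s\<bar> \<le> 1" for s
  proof -
    have "\<bar>hinge \<theta> (s - a) - 2 * hinge \<theta> (s - \<theta>) + hinge \<theta> (s - 2 * \<theta> + a)\<bar> \<le> t"
      using h(10)[of "s - a"] h(10)[of "s - \<theta>"] h(10)[of "s - 2 * \<theta> + a"]
        h(11)[of "s - a"] h(11)[of "s - \<theta>"] h(11)[of "s - 2 * \<theta> + a"]
        h(12)[of "s - a"] h(12)[of "s - \<theta>"] h(12)[of "s - 2 * \<theta> + a"] \<tau> \<theta>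
      unfolding a_def t_def max_def by (simp split: if_splits; linarith)
    then show ?thesis using t by (simp add: w_def)
  qed
  have w_out: "w s = 0" if "s \<ge> \<tau> + 5 * \<theta>" for s
    using that \<tau> \<theta> by (simp add: w_def h(9) a_def)
  have w_low: "w s = hinge \<theta> (s - a) / t" "w' s = hinge' \<theta> (s - a) / t" if "s \<le> \<theta>" for s
    using that \<tau> \<theta> by (simp_all add: w_def w'_def h(6,8) a_def)
  define \<phi> where "\<phi> x = w (u x) *\<^sub>R n x" for x
  define D where "D x v = (w' (u x) * (n x \<bullet> v)) *\<^sub>R n x + w (u x) *\<^sub>R n' x v" for x v
  have wud: "((\<lambda>x. w (u x)) has_derivative (\<lambda>v. w' (u x) * (n x \<bullet> v))) (at x)" for x
    using has_derivative_compose[OF u(4)[rule_format, of x] wd[THEN has_field_derivative_imp_has_derivative]] by simp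
  have \<phi>d: "(\<phi> has_derivative D x) (at x)" for x
    unfolding \<phi>_def[abs_def] D_def[abs_def]
    by (rule has_derivative_eq_rhs, rule has_derivative_scaleR[OF wud u(5)[rule_format, of x]]) (auto simp: add.commute)
  define \<phi>' where "\<phi>' x = Blinfun (D x)" for x
  have app: "blinfun_apply (\<phi>' x) = D x" for x
    unfolding \<phi>'_def by (rule bounded_linear_Blinfun_apply) (rule has_derivative_bounded_linear[OF \<phi>d])
  have tf: "test_field \<phi> \<phi>'"
    unfolding test_field_def
  proof (intro conjI allI)
    show "(\<phi> has_derivative blinfun_apply (\<phi>' x)) (at x)" for x using \<phi>d app by simp
    show "continuous_on UNIV \<phi>'"
    proof (rule continuous_on_blinfun_componentwise)
      show "continuous_on UNIV (\<lambda>x. blinfun_apply (\<phi>' x) i)" for i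
        unfolding app D_def using u(6)
        by (intro continuous_intros cu cn continuous_on_compose2[OF cw' cu] continuous_on_compose2[OF cw cu]) auto
    qed
    have "{x. \<phi> x \<noteq> 0} \<subseteq> {x. u x \<le> \<tau> + 5 * \<theta>}"
      using w_out by (auto simp: \<phi>_def) (meson linear)
    then show "compact (closure {x. \<phi> x \<noteq> 0})" using u(3) bounded_subset compact_closure by blast
    show "norm (\<phi> x) \<le> 1" for x
      using mult_mono[OF w_bound[of "u x"] u(7)[rule_format, of x]] by (simp add: \<phi>_def)
  qed
  have div: "divergence \<phi>' x = w' (u x) * (norm (n x))\<^sup>2 + w (u x) * (\<kappa> * (1 - (norm (n x))\<^sup>2))" for x
  proof -
    have "divergence \<phi>' x = w' (u x) * (\<Sum>i\<in>Basis. (n x \<bullet> i) * (n x \<bullet> i)) + w (u x) * (\<Sum>i\<in>Basis. n' x i \<bullet> i)"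
      unfolding divergence_def app D_def by (simp add: inner_add_left sum.distrib sum_distrib_left mult_ac)
    then show ?thesis using u(8) by (simp add: euclidean_inner[symmetric] dot_square_norm)
  qed
  have I: "(divergence \<phi>' has_integral integral \<Omega> (divergence \<phi>')) \<Omega>"
    using continuous_integrable_on_open[OF continuous_divergence[OF tf] opn bnd] set_lebesgue_integral_eq_integral(1)
    by (blast intro: integrable_integral)
  have "1 / t * (vol \<Omega> - vol (inner_parallel \<Omega> \<tau>)) \<le> integral \<Omega> (divergence \<phi>')"
  proof (rule has_integral_le[OF has_integral_collar I])
    fix x assume x: "x \<in> \<Omega>"
    have ud: "\<bar>u x + dist_bd \<Omega> x\<bar> \<le> \<theta>" using u(1) x by auto
    then have le: "u x \<le> \<theta>" using dist_bd_pos[OF x] by linarith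
    have q: "0 \<le> (norm (n x))\<^sup>2" "(norm (n x))\<^sup>2 \<le> 1" using u(7) by (auto simp: power_le_one)
    have pos: "0 \<le> w (u x)" "0 \<le> w' (u x)" using w_low[OF le] h(3,10) t by auto
    show "1 / t * indicator (\<Omega> - inner_parallel \<Omega> \<tau>) x \<le> divergence \<phi>' x"
    proof (cases "x \<in> inner_parallel \<Omega> \<tau>")
      case True
      then show ?thesis using pos q \<kappa> by (simp add: div)
    next
      case False
      then have "dist_bd \<Omega> x \<le> \<tau>" using x by (auto simp: inner_parallel_def)
      then have ua: "\<theta> \<le> u x - a" using ud unfolding a_def by linarith
      then have w'1: "w' (u x) = 1 / t" using w_low(2)[OF le] h(7) by simp
      have "\<theta> / 2 \<le> hinge \<theta> (u x - a)" using h(9)[OF ua] ua by simp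
      \<comment> \<open>The bound 2 / \<theta> \<le> \<kappa> is tailored to this point: the profile
        is at least \<theta> / (2 t) on the collar, so curvature alone contributes 1 / t.\<close>
      then have "(2 / \<theta>) * (\<theta> / 2) \<le> \<kappa> * hinge \<theta> (u x - a)" using u(9) \<theta> \<kappa> by (intro mult_mono) auto
      then have "1 / t \<le> \<kappa> * w (u x)" using w_low(1)[OF le] \<theta> t by (simp add: divide_right_mono)
      then have "1 / t * (1 - (norm (n x))\<^sup>2) \<le> (\<kappa> * w (u x)) * (1 - (norm (n x))\<^sup>2)"
        using q by (intro mult_right_mono) auto
      then show ?thesis using x False by (simp add: div w'1 algebra_simps)
    qed
  qed
  also have "\<dots> \<le> perimeter \<Omega>" by (rule perimeter_ge[OF tf])
  finally show ?thesis using t by (simp add: t_def field_simps)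
qed

lemma collar_le_perimeter:
  assumes \<tau>: "0 < \<tau>"
  shows "vol \<Omega> - vol (inner_parallel \<Omega> \<tau>) \<le> perimeter \<Omega> * \<tau>"
proof -
  have "((\<lambda>\<theta>. perimeter \<Omega> * (\<tau> + 4 * \<theta>)) \<longlongrightarrow> perimeter \<Omega> * (\<tau> + 4 * 0)) (at_right 0)"
    by (intro tendsto_intros)
  then have "vol \<Omega> - vol (inner_parallel \<Omega> \<tau>) \<le> perimeter \<Omega> * (\<tau> + 4 * 0)"
    by (rule tendsto_lowerbound) (auto intro!: collar_le_perimeter_aux[OF \<tau>] eventually_mono[OF eventually_at_right_less])
  then show ?thesis by simp
qed

section \<open>Inradius and positivity of the perimeter\<close>

lemma vol_pos: "0 < vol \<Omega>"
  by (rule measure_open_pos[OF opn bnd ne])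

lemma bdd_above_inradius: "bdd_above {r. \<exists>x. ball x r \<subseteq> \<Omega>}"
proof -
  obtain B where B: "0 < B" "\<And>z. z \<in> \<Omega> \<Longrightarrow> norm z \<le> B" using bnd by (auto simp: bounded_pos)
  have "r \<le> 4 * B" if "ball x r \<subseteq> \<Omega>" for x r
  proof (rule ccontr)
    assume r: "\<not> r \<le> 4 * B"
    obtain i :: 'a where i: "i \<in> Basis" using nonempty_Basis by blast
    have "x \<in> \<Omega>" "x + (3 * B) *\<^sub>R i \<in> \<Omega>" using that r B(1) i by (auto simp: subset_iff dist_norm)
    then have "norm x \<le> B" "norm (x + (3 * B) *\<^sub>R i) \<le> B" using B by auto
    then show False using norm_triangle_ineq4[of "x + (3 * B) *\<^sub>R i" x] B(1) i by simp
  qed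
  then show ?thesis by (auto intro!: bdd_aboveI)
qed

lemma dist_bd_le_inradius: "x \<in> \<Omega> \<Longrightarrow> dist_bd \<Omega> x \<le> inradius \<Omega>"
  unfolding inradius_def by (rule cSup_upper[OF _ bdd_above_inradius]) (use ball_dist_bd in auto)

lemma inradius_pos: "0 < inradius \<Omega>"
  using ne dist_bd_pos dist_bd_le_inradius by (metis all_not_in_conv less_le_trans)

lemma inner_parallel_empty: "inradius \<Omega> \<le> t \<Longrightarrow> inner_parallel \<Omega> t = {}"
  using dist_bd_le_inradius by (fastforce simp: inner_parallel_def)

lemma less_inradiusE:
  assumes "t < inradius \<Omega>"
  obtains x \<rho> where "t < \<rho>" "ball x \<rho> \<subseteq> \<Omega>"
proof -
  \<comment> \<open>Radius 0 is admissible because its ball is empty.\<close>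
  have "{r. \<exists>x. ball x r \<subseteq> \<Omega>} \<noteq> {}" using ball_empty[of 0] by blast
  then show thesis using assms that unfolding inradius_def by (auto simp: less_cSup_iff[OF _ bdd_above_inradius])
qed

text \<open>At depth equal to the inradius nothing is left, so the collar estimate bounds the whole
  volume by perimeter times inradius.\<close>

lemma perimeter_pos: "0 < perimeter \<Omega>"
proof -
  have "vol \<Omega> \<le> perimeter \<Omega> * inradius \<Omega>"
    using collar_le_perimeter[OF inradius_pos] inner_parallel_empty[of "inradius \<Omega>"] by simp
  then show ?thesis using vol_pos inradius_pos by (metis less_le_trans zero_less_mult_pos2)
qed

text \<open>Let q be the N-th root of V(t) / V(0). Brunn--Minkowski for (1 - s) \<Omega> + s W,
  which lies at depth above s t, gives V(s t)^(1/N) \<ge> (1 - s (1 - q)) V(0)^(1/N). Bernoulli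
  makes this linear in s, and \<open>perimeter_le\<close> turns the slope into P \<le> N V(0) (1 -
  q) / t. Solving for q is the second claim; q \<ge> 0 then gives the first.\<close>

lemma inner_parallel_vol_upper:
  assumes t: "0 < t" "t < inradius \<Omega>"
  shows "t \<le> DIM('a) * vol \<Omega> / perimeter \<Omega>"
    "vol (inner_parallel \<Omega> t) \<le> vol \<Omega> * (1 - t * perimeter \<Omega> / (DIM('a) * vol \<Omega>)) ^ DIM('a)"
proof -
  let ?N = "DIM('a)"
  let ?W = "inner_parallel \<Omega> t"
  have N: "?N > 0" by simp
  obtain x \<rho> where x: "t < \<rho>" "ball x \<rho> \<subseteq> \<Omega>" by (rule less_inradiusE[OF t(2)])
  then have "x \<in> ?W" using le_dist_bd[OF x(2)] t by (auto simp: inner_parallel_def)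
  then have W: "open ?W" "bounded ?W" "?W \<noteq> {}" using inner_parallel_open inner_parallel_bounded by auto
  define q where "q = root ?N (vol ?W / vol \<Omega>)"
  have Wle: "vol ?W \<le> vol \<Omega>"
    by (intro measure_mono_fmeasurable inner_parallel_subset lmeasurable_\<Omega> fmeasurableD)
  have q: "0 \<le> q" "q \<le> 1" "root ?N (vol ?W) = q * root ?N (vol \<Omega>)"
    using vol_pos Wle by (auto simp: q_def real_root_divide)
  have qN: "vol ?W = q ^ ?N * vol \<Omega>" using vol_pos by (simp add: q_def)
  have growth: "vol \<Omega> - vol (inner_parallel \<Omega> \<epsilon>) \<le> (?N * vol \<Omega> * (1 - q) / t) * \<epsilon>" if \<epsilon>: "0 < \<epsilon>" "\<epsilon> < t" for \<epsilon>
  proof -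
    define s where "s = \<epsilon> / t"
    have s: "0 < s" "s < 1" "s * t = \<epsilon>" using \<epsilon> t by (auto simp: s_def)
    \<comment> \<open>The summand 0 matches the affine form of
      \<open>measure_affine_image\<close>.\<close>
    let ?A = "(\<lambda>x. (1 - s) *\<^sub>R x + 0) ` \<Omega>" and ?B = "(\<lambda>x. s *\<^sub>R x + 0) ` ?W"
    have A: "open ?A" "bounded ?A" "?A \<noteq> {}" and B: "open ?B" "bounded ?B" "?B \<noteq> {}"
      using opn bnd ne W s by (auto intro!: open_scaling bounded_scaling)
    have sub: "minkowski_sum ?A ?B \<subseteq> inner_parallel \<Omega> \<epsilon>"
    proof
      fix z assume "z \<in> minkowski_sum ?A ?B"
      then obtain x y where xy: "x \<in> \<Omega>" "y \<in> ?W" "z = (1 - s) *\<^sub>R x + s *\<^sub>R y" by (auto simp: minkowski_sum_iff)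
      then have y: "y \<in> \<Omega>" "t < dist_bd \<Omega> y" by (auto simp: inner_parallel_def)
      have "\<epsilon> = s * t" using s by simp
      also have "\<dots> < s * dist_bd \<Omega> y" using s(1) y by (intro mult_strict_left_mono)
      also have "\<dots> \<le> (1 - s) * dist_bd \<Omega> x + s * dist_bd \<Omega> y" using s dist_bd_pos[OF xy(1)] by simp
      also have "\<dots> \<le> dist_bd \<Omega> z" unfolding xy(3) using s xy y by (intro dist_bd_concave) auto
      finally show "z \<in> inner_parallel \<Omega> \<epsilon>"
        using convexD_alt[OF conv xy(1) y(1), of s] s xy(3) by (auto simp: inner_parallel_def)
    qed
    have "((1 - s) + s * q) * root ?N (vol \<Omega>) = root ?N (measure lebesgue ?A) + root ?N (measure lebesgue ?B)"
      unfolding measure_affine_image using s N q(3) by (simp add: real_root_mult real_root_power_cancel algebra_simps)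
    also have "\<dots> \<le> root ?N (measure lebesgue (minkowski_sum ?A ?B))" by (rule brunn_minkowski_open[OF A B])
    also have "\<dots> \<le> root ?N (vol (inner_parallel \<Omega> \<epsilon>))"
      using open_minkowski_sum[OF A(1)] by (intro real_root_le_mono measure_mono_fmeasurable sub lmeasurable_\<Omega>) auto
    finally have *: "(((1 - s) + s * q) * root ?N (vol \<Omega>)) ^ ?N \<le> root ?N (vol (inner_parallel \<Omega> \<epsilon>)) ^ ?N"
      using s q(1) by (intro power_mono) auto
    have 1: "(1 + (- (s * (1 - q)))) ^ ?N * vol \<Omega> \<le> vol (inner_parallel \<Omega> \<epsilon>)"
    proof -
      have "(1 - s) + s * q = 1 + (- (s * (1 - q)))" by (simp add: algebra_simps)
      then show ?thesis using * by (simp only: power_mult_distrib real_root_pow_pos2[OF N] measure_nonneg)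
    qed
    have "s * (1 - q) \<le> 1 * 1" using s q by (intro mult_mono) auto
    then have "1 + ?N * (- (s * (1 - q))) \<le> (1 + (- (s * (1 - q)))) ^ ?N"
      by (intro Bernoulli_inequality) auto
    then have "(1 + ?N * (- (s * (1 - q)))) * vol \<Omega> \<le> (1 + (- (s * (1 - q)))) ^ ?N * vol \<Omega>"
      by (intro mult_right_mono) auto
    then have "vol \<Omega> - vol (inner_parallel \<Omega> \<epsilon>) \<le> ?N * vol \<Omega> * (1 - q) * s"
      using 1 by (simp add: algebra_simps)
    then show ?thesis by (simp add: s_def)
  qed
  have "perimeter \<Omega> \<le> ?N * vol \<Omega> * (1 - q) / t"
    by (rule perimeter_le[OF t(1)]) (use growth in auto)
  then have "t * perimeter \<Omega> \<le> ?N * vol \<Omega> * (1 - q)" using t by (simp add: field_simps)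
  then have le: "q \<le> 1 - t * perimeter \<Omega> / (?N * vol \<Omega>)" using vol_pos by (simp add: field_simps)
  then have "t * perimeter \<Omega> / (?N * vol \<Omega>) \<le> 1" using q(1) by linarith
  then show "t \<le> ?N * vol \<Omega> / perimeter \<Omega>" using vol_pos perimeter_pos by (simp add: field_simps)
  have "q ^ ?N \<le> (1 - t * perimeter \<Omega> / (?N * vol \<Omega>)) ^ ?N" by (rule power_mono[OF le q(1)])
  then show "vol ?W \<le> vol \<Omega> * (1 - t * perimeter \<Omega> / (?N * vol \<Omega>)) ^ ?N"
    using vol_pos by (simp add: qN)
qed

end

section \<open>Moments of the distance function\<close>

text \<open>Rescaling to [0,1] gives a Beta integral, and \<beta> Beta(\<beta>, N + 1) is the
  reciprocal of the generalized binomial. \<open>N\<close> is a free exponent here: it becomes 1 for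
  the lower bound and for slabs, and the dimension for the upper bound.\<close>

lemma has_integral_powr_Beta:
  fixes N :: nat
  assumes T: "0 < T" and \<beta>: "0 < \<beta>"
  shows "((\<lambda>s. \<beta> * s powr (\<beta> - 1) * (1 - s / T) ^ N) has_integral T powr \<beta> / gbinom N \<beta>) {0<..<T}"
proof -
  have "((\<lambda>t. t powr (\<beta> - 1) * (1 - t) powr (real N + 1 - 1)) has_integral Beta \<beta> (real N + 1)) {0..1}"
    by (rule has_integral_Beta_real) (use \<beta> in auto)
  from has_integral_stretch_real[OF this, of "1 / T"]
  have "((\<lambda>s. (s / T) powr (\<beta> - 1) * (1 - s / T) powr real N) has_integral T * Beta \<beta> (real N + 1)) {0..T}"
    using T image_mult_atLeastAtMost[of T 0 1] by (simp add: mult.commute[of _ T])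
  then have "((\<lambda>s. (s / T) powr (\<beta> - 1) * (1 - s / T) powr real N) has_integral T * Beta \<beta> (real N + 1)) {0<..<T}"
    by (simp add: has_integral_Icc_iff_Ioo)
  from has_integral_mult_right[OF this, of "\<beta> * T powr (\<beta> - 1)"]
  have 1: "((\<lambda>s. \<beta> * T powr (\<beta> - 1) * ((s / T) powr (\<beta> - 1) * (1 - s / T) powr real N)) has_integral
      \<beta> * T powr (\<beta> - 1) * (T * Beta \<beta> (real N + 1))) {0<..<T}" .
  have "T powr \<beta> = T powr (\<beta> - 1) * T" using T by (simp add: powr_diff)
  moreover have "\<beta> * Beta \<beta> (real N + 1) = 1 / gbinom N \<beta>"
    using Gamma_plus1[of \<beta>] \<beta> by (simp add: Beta_def gbinom_def add_ac nonpos_Ints_def)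
  ultimately have 2: "\<beta> * T powr (\<beta> - 1) * (T * Beta \<beta> (real N + 1)) = T powr \<beta> / gbinom N \<beta>"
    by (metis (no_types, opaque_lifting) mult.commute mult.left_commute times_divide_eq_right mult.right_neutral)
  have 3: "\<beta> * T powr (\<beta> - 1) * ((s / T) powr (\<beta> - 1) * (1 - s / T) powr real N) = \<beta> * s powr (\<beta> - 1) * (1 - s / T) ^ N"
    if "s \<in> {0<..<T}" for s
    using that T by (simp add: powr_divide powr_realpow)
  show ?thesis using has_integral_eq[OF 3 1] by (simp only: 2)
qed

lemma gbinom_1:
  assumes "0 < \<beta>"
  shows "gbinom 1 \<beta> = \<beta> + 1"
proof -
  have "Gamma (\<beta> + 1) \<noteq> 0"
    by (rule less_imp_neq[OF Gamma_real_pos, symmetric]) (use assms in simp)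
  then show ?thesis using Gamma_plus1[of "\<beta> + 1"] assms
    by (simp add: gbinom_def Gamma_numeral add_ac nonpos_Ints_def)
qed

context bounded_convex_open
begin

text \<open>Tonelli on the region 0 < s < d(x): integrating \<beta> s^(\<beta>-1) over s first gives
  d^\<beta>, over x first gives the volume of the inner parallel set. The exchange happens for
  extended nonnegative integrals, with conversions from and to gauge integrals at the ends.\<close>

lemma layer_cake:
  assumes \<beta>: "1 \<le> \<beta>"
  shows "((\<lambda>s. \<beta> * s powr (\<beta> - 1) * vol (inner_parallel \<Omega> s)) has_integral
    integral \<Omega> (\<lambda>x. dist_bd \<Omega> x powr \<beta>)) {0<..<inradius \<Omega>}"
proof -
  let ?d = "dist_bd \<Omega>"
  define J where "J = integral \<Omega> (\<lambda>x. ?d x powr \<beta>)"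
  define V where "V s = vol (inner_parallel \<Omega> s)" for s
  define K where "K x s = ennreal (if x \<in> \<Omega> \<and> 0 < s \<and> s < ?d x then \<beta> * s powr (\<beta> - 1) else 0)" for x s
  have d0: "0 \<le> ?d x" for x by (simp add: dist_bd_def infdist_nonneg)
  have "continuous_on UNIV (\<lambda>x. ?d x powr \<beta>)"
    using \<beta> d0 by (intro continuous_on_powr' continuous_dist_bd continuous_intros) auto
  from continuous_integrable_on_open[OF this opn bnd]
  have J: "((\<lambda>x. ?d x powr \<beta>) has_integral J) \<Omega>"
    unfolding J_def using set_lebesgue_integral_eq_integral(1) by (blast intro: integrable_integral)
  have J0: "0 \<le> J" unfolding J_def by (rule integral_nonneg) (use J in auto)
  have [measurable]: "\<Omega> \<in> sets borel" "?d \<in> borel_measurable borel"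
    using opn continuous_dist_bd by (auto intro: borel_measurable_continuous_onI)
  have inner1: "(\<integral>\<^sup>+s. K x s \<partial>lborel) = ennreal (?d x powr \<beta>) * indicator \<Omega> x" for x
  proof (cases "x \<in> \<Omega>")
    case True
    have "((\<lambda>s. s powr (\<beta> - 1)) has_integral (?d x powr (\<beta> - 1 + 1) / (\<beta> - 1 + 1))) {0..?d x}"
      using \<beta> d0 by (intro has_integral_powr_from_0) auto
    then have "((\<lambda>s. s powr (\<beta> - 1)) has_integral (?d x powr \<beta> / \<beta>)) {0<..<?d x}"
      by (simp add: has_integral_Icc_iff_Ioo)
    from has_integral_mult_right[OF this, of \<beta>]
    have "((\<lambda>s. \<beta> * s powr (\<beta> - 1)) has_integral ?d x powr \<beta>) {0<..<?d x}" using \<beta> by simp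
    from nn_integral_has_integral_lebesgue'[OF _ this]
    have "(\<integral>\<^sup>+s. ennreal (\<beta> * s powr (\<beta> - 1)) * indicator {0<..<?d x} s \<partial>lborel) = ennreal (?d x powr \<beta>)"
      using \<beta> by simp
    moreover have "K x s = ennreal (\<beta> * s powr (\<beta> - 1)) * indicator {0<..<?d x} s" for s
      using True by (auto simp: K_def indicator_def)
    ultimately show ?thesis using True by simp
  qed (simp add: K_def)
  have inner2: "(\<integral>\<^sup>+x. K x s \<partial>lborel) = ennreal (if 0 < s then \<beta> * s powr (\<beta> - 1) * V s else 0)" for s
  proof (cases "0 < s")
    case True
    have m: "inner_parallel \<Omega> s \<in> sets borel" using inner_parallel_open by auto
    have "(\<integral>\<^sup>+x. K x s \<partial>lborel) = (\<integral>\<^sup>+x. ennreal (\<beta> * s powr (\<beta> - 1)) * indicator (inner_parallel \<Omega> s) x \<partial>lborel)"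
      using True by (intro nn_integral_cong) (auto simp: K_def inner_parallel_def indicator_def)
    also have "\<dots> = ennreal (\<beta> * s powr (\<beta> - 1)) * emeasure lborel (inner_parallel \<Omega> s)"
      using m by (subst nn_integral_cmult_indicator) auto
    also have "emeasure lborel (inner_parallel \<Omega> s) = ennreal (V s)"
      using emeasure_eq_measure2[OF lmeasurable_\<Omega>(2)[of s]] m by (simp add: V_def)
    finally show ?thesis using True \<beta> by (simp add: ennreal_mult V_def)
  qed (simp add: K_def)
  have "(\<lambda>(x, s). K x s) \<in> borel_measurable (lborel \<Otimes>\<^sub>M lborel)"
    unfolding K_def by measurable
  then have "(\<integral>\<^sup>+s. \<integral>\<^sup>+x. K x s \<partial>lborel \<partial>lborel) = (\<integral>\<^sup>+x. \<integral>\<^sup>+s. K x s \<partial>lborel \<partial>lborel)"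
    by (rule lborel_pair.Fubini')
  also have "\<dots> = ennreal J"
    unfolding inner1 by (rule nn_integral_has_integral_lebesgue'[OF _ J]) simp
  finally have eq: "(\<integral>\<^sup>+s. ennreal (if 0 < s then \<beta> * s powr (\<beta> - 1) * V s else 0) \<partial>lborel) = ennreal J"
    unfolding inner2 .
  \<comment> \<open>Monotonicity in the depth supplies measurability; the sign makes the decreasing
    volume increasing.\<close>
  have "mono (\<lambda>s. - V s)"
  proof (rule monoI)
    fix s t :: real assume "s \<le> t"
    then have "inner_parallel \<Omega> t \<subseteq> inner_parallel \<Omega> s" by (auto simp: inner_parallel_def)
    then have "V t \<le> V s"
      unfolding V_def by (intro measure_mono_fmeasurable fmeasurableD lmeasurable_\<Omega>)
    then show "- V s \<le> - V t" by simp
  qed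
  then have "(\<lambda>s. - (- V s)) \<in> borel_measurable borel"
    by (intro borel_measurable_uminus borel_measurable_mono)
  then have Vm[measurable]: "V \<in> borel_measurable borel" by simp
  have "((\<lambda>s. if 0 < s then \<beta> * s powr (\<beta> - 1) * V s else 0) has_integral J) UNIV"
    by (rule nn_integral_has_integral[OF _ _ eq J0]) (use \<beta> in \<open>auto simp: V_def\<close>)
  moreover have "(\<lambda>s. if 0 < s then \<beta> * s powr (\<beta> - 1) * V s else 0) =
    (\<lambda>s. if s \<in> {0<..<inradius \<Omega>} then \<beta> * s powr (\<beta> - 1) * V s else 0)"
    using inner_parallel_empty by (auto simp: V_def fun_eq_iff)
  ultimately have "((\<lambda>s. if s \<in> {0<..<inradius \<Omega>} then \<beta> * s powr (\<beta> - 1) * V s else 0) has_integral J) UNIV"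
    by (simp only:)
  then show ?thesis unfolding has_integral_restrict_UNIV V_def J_def .
qed

lemma powr_integral_nonneg: "1 \<le> \<beta> \<Longrightarrow> 0 \<le> integral \<Omega> (\<lambda>x. dist_bd \<Omega> x powr \<beta>)"
  by (rule has_integral_nonneg[OF layer_cake]) auto

text \<open>Comparison with the model profile up to T. Between the inradius and T the true volume is
  0 while the model is positive, which is the source of strictness.\<close>

lemma powr_integral_le:
  fixes k :: nat
  assumes \<beta>: "1 \<le> \<beta>" and T: "inradius \<Omega> \<le> T" and c: "0 \<le> c"
    and V: "\<And>s. 0 < s \<Longrightarrow> s < inradius \<Omega> \<Longrightarrow> vol (inner_parallel \<Omega> s) \<le> c * (1 - s / T) ^ k"
  shows "integral \<Omega> (\<lambda>x. dist_bd \<Omega> x powr \<beta>) \<le> c * (T powr \<beta> / gbinom k \<beta>)"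
    and "inradius \<Omega> < T \<Longrightarrow> 0 < c \<Longrightarrow> integral \<Omega> (\<lambda>x. dist_bd \<Omega> x powr \<beta>) < c * (T powr \<beta> / gbinom k \<beta>)"
proof -
  let ?r = "inradius \<Omega>"
  let ?J = "integral \<Omega> (\<lambda>x. dist_bd \<Omega> x powr \<beta>)"
  let ?f = "\<lambda>s. \<beta> * s powr (\<beta> - 1) * vol (inner_parallel \<Omega> s)"
  have T0: "0 < T" using inradius_pos T by linarith
  have B: "((\<lambda>s. c * (\<beta> * s powr (\<beta> - 1) * (1 - s / T) ^ k)) has_integral c * (T powr \<beta> / gbinom k \<beta>)) {0<..<T}"
    by (intro has_integral_mult_right has_integral_powr_Beta) (use T0 \<beta> in auto)
  have A: "((\<lambda>s. if s \<in> {0<..<?r} then ?f s else 0) has_integral ?J) {0<..<T}"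
    using layer_cake[OF \<beta>] T by (subst has_integral_restrict) auto
  have fle: "?f s \<le> c * (\<beta> * s powr (\<beta> - 1) * (1 - s / T) ^ k)" if "0 < s" "s < ?r" for s
    using mult_left_mono[OF V[OF that], of "\<beta> * s powr (\<beta> - 1)"] \<beta> by (simp add: mult_ac)
  have Bpos: "0 \<le> c * (\<beta> * s powr (\<beta> - 1) * (1 - s / T) ^ k)" if "s < T" for s
    using c \<beta> that T0 by simp
  show "?J \<le> c * (T powr \<beta> / gbinom k \<beta>)"
    by (rule has_integral_le[OF A B]) (use fle Bpos in auto)
  assume rT: "?r < T" and c0: "0 < c"
  \<comment> \<open>On the interval from the inradius to this midpoint the model stays above a
    positive constant: s is at least the inradius and 1 - s / T at least its value at q.\<close>
  define q where "q = (?r + T) / 2"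
  have q: "?r < q" "q < T" using rT by (auto simp: q_def)
  define m where "m = c * (\<beta> * ?r powr (\<beta> - 1) * (1 - q / T) ^ k)"
  have m: "0 < m" using c0 \<beta> inradius_pos q T0 by (simp add: m_def)
  have mle: "m \<le> c * (\<beta> * s powr (\<beta> - 1) * (1 - s / T) ^ k)" if "s \<in> {?r..q}" for s
    unfolding m_def using that inradius_pos \<beta> c q T0
    by (intro mult_left_mono mult_mono powr_mono2 power_mono) (auto simp: divide_right_mono)
  have "((\<lambda>s. m) has_integral (q - ?r) * m) {?r..q}" using has_integral_const_real[of m ?r q] q by simp
  then have "((\<lambda>s. if s \<in> {?r..q} then m else 0) has_integral (q - ?r) * m) {0<..<T}"
    using q inradius_pos by (subst has_integral_restrict) auto
  from has_integral_add[OF A this]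
  have "?J + (q - ?r) * m \<le> c * (T powr \<beta> / gbinom k \<beta>)"
    by (rule has_integral_le[OF _ B]) (use fle Bpos mle q in auto)
  moreover have "0 < (q - ?r) * m" using q m by simp
  ultimately show "?J < c * (T powr \<beta> / gbinom k \<beta>)" by linarith
qed

text \<open>The reverse comparison: here T does not exceed the inradius, and the model is continued
  by 0 beyond T.\<close>

lemma powr_integral_ge:
  fixes k :: nat
  assumes \<beta>: "1 \<le> \<beta>" and T: "0 < T" "T \<le> inradius \<Omega>"
    and V: "\<And>s. 0 < s \<Longrightarrow> s < T \<Longrightarrow> c * (1 - s / T) ^ k \<le> vol (inner_parallel \<Omega> s)"
  shows "c * (T powr \<beta> / gbinom k \<beta>) \<le> integral \<Omega> (\<lambda>x. dist_bd \<Omega> x powr \<beta>)"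
proof -
  let ?r = "inradius \<Omega>"
  have "((\<lambda>s. c * (\<beta> * s powr (\<beta> - 1) * (1 - s / T) ^ k)) has_integral c * (T powr \<beta> / gbinom k \<beta>)) {0<..<T}"
    by (intro has_integral_mult_right has_integral_powr_Beta) (use T \<beta> in auto)
  then have A: "((\<lambda>s. if s \<in> {0<..<T} then c * (\<beta> * s powr (\<beta> - 1) * (1 - s / T) ^ k) else 0) has_integral c * (T powr \<beta> / gbinom k \<beta>)) {0<..<?r}"
    using T by (subst has_integral_restrict) auto
  show ?thesis
  proof (rule has_integral_le[OF A layer_cake[OF \<beta>]])
    fix s assume "s \<in> {0<..<?r}"
    then show "(if s \<in> {0<..<T} then c * (\<beta> * s powr (\<beta> - 1) * (1 - s / T) ^ k) else 0) \<le> \<beta> * s powr (\<beta> - 1) * vol (inner_parallel \<Omega> s)"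
      using mult_left_mono[OF V[of s], of "\<beta> * s powr (\<beta> - 1)"] \<beta> by (auto simp: mult_ac)
  qed
qed

text \<open>With T = V(0) / P the collar estimate V(0) - s P is the model profile of exponent 1, and
  the same estimate at the inradius shows that T does not exceed it.\<close>

lemma Ffun_lower:
  assumes \<beta>: "1 \<le> \<beta>"
  shows "1 / (\<beta> + 1) \<le> Ffun \<beta> \<Omega>"
proof -
  let ?V = "vol \<Omega>" and ?P = "perimeter \<Omega>"
  define T where "T = ?V / ?P"
  have T: "0 < T" "T \<le> inradius \<Omega>"
    using vol_pos perimeter_pos collar_le_perimeter[OF inradius_pos] inner_parallel_empty[of "inradius \<Omega>"]
    by (auto simp: T_def field_simps)
  have "?V * (T powr \<beta> / gbinom (real 1) \<beta>) \<le> integral \<Omega> (\<lambda>x. dist_bd \<Omega> x powr \<beta>)"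
  proof (rule powr_integral_ge[OF \<beta> T])
    show "?V * (1 - s / T) ^ 1 \<le> vol (inner_parallel \<Omega> s)" if "0 < s" for s
      using collar_le_perimeter[OF that] vol_pos by (simp add: T_def right_diff_distrib mult.commute)
  qed
  then have "(?P / ?V) powr \<beta> * (1 / ?V) * (?V * (T powr \<beta> / (\<beta> + 1))) \<le> Ffun \<beta> \<Omega>"
    unfolding Ffun_def using \<beta> vol_pos by (intro mult_left_mono) (auto simp: gbinom_1)
  moreover have "(?P / ?V) powr \<beta> * T powr \<beta> = 1"
    using vol_pos perimeter_pos by (simp add: T_def powr_mult[symmetric])
  ultimately show ?thesis using vol_pos by simp
qed

text \<open>The model has exponent N and T = N V(0) / P. Equality forces r = T through the strict
  comparison; conversely r = T makes the homothety bound coincide with the upper estimate.\<close>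

lemma Ffun_upper:
  assumes \<beta>: "1 \<le> \<beta>"
  shows "Ffun \<beta> \<Omega> \<le> real DIM('a) powr \<beta> / gbinom (real DIM('a)) \<beta>"
    and "Ffun \<beta> \<Omega> = real DIM('a) powr \<beta> / gbinom (real DIM('a)) \<beta> \<longleftrightarrow>
      vol \<Omega> = perimeter \<Omega> * inradius \<Omega> / real DIM('a)"
proof -
  let ?V = "vol \<Omega>" and ?P = "perimeter \<Omega>" and ?N = "DIM('a)" and ?r = "inradius \<Omega>"
  let ?J = "integral \<Omega> (\<lambda>x. dist_bd \<Omega> x powr \<beta>)"
  let ?b = "real ?N powr \<beta> / gbinom (real ?N) \<beta>"
  define T where "T = ?N * ?V / ?P"
  have T0: "0 < T" using vol_pos perimeter_pos by (simp add: T_def)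
  have rT: "?r \<le> T"
    by (rule dense_le_bounded[OF inradius_pos]) (use inner_parallel_vol_upper(1) in \<open>auto simp: T_def\<close>)
  have up: "vol (inner_parallel \<Omega> s) \<le> ?V * (1 - s / T) ^ ?N" if "0 < s" "s < ?r" for s
    using inner_parallel_vol_upper(2)[OF that] by (simp add: T_def)
  let ?k = "(?P / ?V) powr \<beta> * (1 / ?V)"
  have k: "0 < ?k" using vol_pos perimeter_pos by simp
  have kb: "?k * (?V * (T powr \<beta> / gbinom ?N \<beta>)) = ?b"
  proof -
    have "(?P / ?V) powr \<beta> * T powr \<beta> = real ?N powr \<beta>"
      using vol_pos perimeter_pos by (simp add: T_def powr_mult[symmetric])
    then show ?thesis using vol_pos by simp
  qed
  have F: "Ffun \<beta> \<Omega> = ?k * ?J" by (simp add: Ffun_def)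
  have le: "?J \<le> ?V * (T powr \<beta> / gbinom ?N \<beta>)"
    by (rule powr_integral_le(1)[OF \<beta> rT _ up]) auto
  show "Ffun \<beta> \<Omega> \<le> ?b" unfolding F kb[symmetric] using k le by (intro mult_left_mono) auto
  have eq_T: "?V = ?P * ?r / real ?N \<longleftrightarrow> ?r = T"
    using vol_pos perimeter_pos by (auto simp: T_def field_simps)
  show "Ffun \<beta> \<Omega> = ?b \<longleftrightarrow> ?V = ?P * ?r / real ?N"
    unfolding eq_T
  proof
    assume "Ffun \<beta> \<Omega> = ?b"
    then have "?k * ?J = ?k * (?V * (T powr \<beta> / gbinom ?N \<beta>))" unfolding F kb[symmetric] .
    then have "?J = ?V * (T powr \<beta> / gbinom ?N \<beta>)"
      by (rule mult_left_cancel[THEN iffD1, rotated]) (use k in auto)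
    then show "?r = T" using powr_integral_le(2)[OF \<beta> rT _ up] rT vol_pos by force
  next
    assume r: "?r = T"
    have "?V * (T powr \<beta> / gbinom ?N \<beta>) \<le> ?J"
    proof (rule powr_integral_ge[OF \<beta> T0])
      fix s assume s: "0 < s" "s < T"
      \<comment> \<open>Inscribed balls are at hand for every radius \<rho> < T; the bound at T
        itself follows by letting \<rho> tend to T from below.\<close>
      have "(1 - s / \<rho>) ^ ?N * ?V \<le> vol (inner_parallel \<Omega> s)" if \<rho>: "s < \<rho>" "\<rho> < T" for \<rho>
      proof -
        obtain x \<rho>' where "\<rho> < \<rho>'" "ball x \<rho>' \<subseteq> \<Omega>" using less_inradiusE[of \<rho>] \<rho> r by metis
        then have "ball x \<rho> \<subseteq> \<Omega>" by (meson less_imp_le order_trans subset_ball)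
        then show ?thesis using inner_parallel_homothety[of x \<rho> s] s \<rho> by simp
      qed
      moreover have "((\<lambda>\<rho>. (1 - s / \<rho>) ^ ?N * ?V) \<longlongrightarrow> (1 - s / T) ^ ?N * ?V) (at_left T)"
        using T0 by (intro tendsto_intros) auto
      moreover have "eventually (\<lambda>\<rho>. s < \<rho> \<and> \<rho> < T) (at_left T)"
        using eventually_at_left_real[OF s(2)] by (auto elim: eventually_mono)
      ultimately have "(1 - s / T) ^ ?N * ?V \<le> vol (inner_parallel \<Omega> s)"
        by (intro tendsto_upperbound[where F = "at_left T"]) (auto elim!: eventually_mono)
      then show "?V * (1 - s / T) ^ ?N \<le> vol (inner_parallel \<Omega> s)" by (simp add: mult.commute)
    qed (use r in auto)
    then have "?J = ?V * (T powr \<beta> / gbinom ?N \<beta>)" using le by simp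
    then show "Ffun \<beta> \<Omega> = ?b" unfolding F kb[symmetric] by simp
  qed
qed

end

section \<open>Slabs\<close>

lemma prod_Basis_insert:
  fixes p q :: real
  assumes "e \<in> (Basis :: 'a::euclidean_space set)"
  shows "(\<Prod>i\<in>Basis. if i = e then p else q) = p * q ^ (DIM('a) - 1)"
  using assms by (subst prod.remove[of _ e]) (auto simp: card_Diff_singleton)

locale slab_domain =
  fixes e :: "'a::euclidean_space" and L :: real
  assumes e: "e \<in> Basis" and L: "0 < L"
begin

definition corner :: "real \<Rightarrow> real \<Rightarrow> 'a" where
  "corner p q = (\<Sum>i\<in>Basis. (if i = e then p else q) *\<^sub>R i)"

lemma corner_inner: "i \<in> Basis \<Longrightarrow> corner p q \<bullet> i = (if i = e then p else q)"
  unfolding corner_def by simp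

lemma slab_eq_box: "slab e L = box (corner 0 (- L / 2)) (corner 1 (L / 2))"
proof -
  have *: "(\<forall>i\<in>Basis. P i) \<longleftrightarrow> P e \<and> (\<forall>i\<in>Basis - {e}. P i)" for P using e by auto
  show ?thesis
    unfolding slab_def box_def * using e by (auto simp: corner_inner)
qed

lemma measure_box_corner:
  assumes "p < p'" "q < q'"
  shows "vol (box (corner p q) (corner p' q')) = (p' - p) * (q' - q) ^ (DIM('a) - 1)"
proof -
  have ne: "box (corner p q) (corner p' q') \<noteq> {}" using assms by (auto simp: box_ne_empty corner_inner)
  have "(\<Prod>i\<in>Basis. (corner p' q' - corner p q) \<bullet> i) = (\<Prod>i\<in>Basis. if i = e then p' - p else q' - q)"
    by (rule prod.cong) (auto simp: inner_diff_left corner_inner)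
  then show ?thesis unfolding measure_box_ne[OF ne] using prod_Basis_insert[OF e] by simp
qed

sublocale bounded_convex_open "slab e L"
proof
  show "slab e L \<noteq> {}" unfolding slab_eq_box using L by (auto simp: box_ne_empty corner_inner)
qed (auto simp: slab_eq_box)

lemma bounded_convex_open_slab: "bounded_convex_open (slab e L)" ..

lemma vol_slab: "vol (slab e L) = L ^ (DIM('a) - 1)"
  unfolding slab_eq_box using L by (subst measure_box_corner) auto

text \<open>Moving \<open>x\<close> along \<open>e\<close> to either of the faces orthogonal to
  \<open>e\<close> leaves the slab.\<close>

lemma dist_bd_slab_le:
  assumes x: "x \<in> slab e L"
  shows "dist_bd (slab e L) x \<le> x \<bullet> e" "dist_bd (slab e L) x \<le> 1 - x \<bullet> e"
proof -
  have *: "dist_bd (slab e L) x \<le> \<bar>c\<bar>" if "x \<bullet> e + c = 0 \<or> x \<bullet> e + c = 1" for c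
  proof -
    have "x + c *\<^sub>R e \<notin> slab e L" using that e by (auto simp: slab_def inner_add_left inner_Basis)
    from dist_bd_le[OF this x] show ?thesis using e by (simp add: dist_norm)
  qed
  show "dist_bd (slab e L) x \<le> x \<bullet> e" "dist_bd (slab e L) x \<le> 1 - x \<bullet> e"
    using *[of "- (x \<bullet> e)"] *[of "1 - x \<bullet> e"] x by (auto simp: slab_def)
qed

lemma inradius_slab_le: "inradius (slab e L) \<le> 1 / 2"
proof (rule dense_le)
  fix t assume "t < inradius (slab e L)"
  then show "t \<le> 1 / 2"
  proof (cases "0 < t")
    case True
    obtain x \<rho> where x: "t < \<rho>" "ball x \<rho> \<subseteq> slab e L" by (rule less_inradiusE[OF \<open>t < inradius (slab e L)\<close>])
    then have "x \<in> slab e L" using True by auto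
    then show ?thesis using le_dist_bd[OF x(2)] dist_bd_slab_le[of x] x(1) by linarith
  qed simp
qed

text \<open>Shrinking along \<open>e\<close> alone already gives the model profile with exponent 1
  and T = 1/2, the shape that is extremal for the lower bound.\<close>

lemma inner_parallel_slab_le:
  assumes "0 < s" "s < inradius (slab e L)"
  shows "vol (inner_parallel (slab e L) s) \<le> vol (slab e L) * (1 - s / (1 / 2)) ^ 1"
proof -
  have s: "s < 1 / 2" using assms inradius_slab_le by linarith
  have "inner_parallel (slab e L) s \<subseteq> box (corner s (- L / 2)) (corner (1 - s) (L / 2))"
  proof
    fix x assume "x \<in> inner_parallel (slab e L) s"
    then have x: "x \<in> slab e L" "s < dist_bd (slab e L) x" by (auto simp: inner_parallel_def)
    then show "x \<in> box (corner s (- L / 2)) (corner (1 - s) (L / 2))"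
      using dist_bd_slab_le[OF x(1)] by (auto simp: mem_box corner_inner slab_def)
  qed
  then have "vol (inner_parallel (slab e L) s) \<le> vol (box (corner s (- L / 2)) (corner (1 - s) (L / 2)))"
    by (intro measure_mono_fmeasurable fmeasurableD lmeasurable_\<Omega>) auto
  then show ?thesis using s L by (subst (asm) measure_box_corner) (auto simp: vol_slab mult.commute)
qed

text \<open>A point outside the slab violates one coordinate constraint, and in that coordinate it
  is more than \<epsilon> away from every point of the smaller box.\<close>

lemma inner_parallel_slab_ge:
  assumes "0 < \<epsilon>" "\<epsilon> < min (1 / 2) (L / 2)"
  shows "(1 - 2 * \<epsilon>) * (L - 2 * \<epsilon>) ^ (DIM('a) - 1) \<le> vol (inner_parallel (slab e L) \<epsilon>)"
proof -
  have "box (corner \<epsilon> (\<epsilon> - L / 2)) (corner (1 - \<epsilon>) (L / 2 - \<epsilon>)) \<subseteq> inner_parallel (slab e L) \<epsilon>"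
  proof
    fix x assume x: "x \<in> box (corner \<epsilon> (\<epsilon> - L / 2)) (corner (1 - \<epsilon>) (L / 2 - \<epsilon>))"
    have xs: "x \<in> slab e L"
      using x assms(1) unfolding slab_eq_box by (fastforce simp: mem_box corner_inner split: if_splits)
    obtain y where y: "y \<notin> slab e L" "dist_bd (slab e L) x = dist x y" by (rule dist_bd_attained)
    obtain i where i: "i \<in> Basis" "y \<bullet> i \<le> corner 0 (- L / 2) \<bullet> i \<or> corner 1 (L / 2) \<bullet> i \<le> y \<bullet> i"
      using y(1) unfolding slab_eq_box mem_box by (meson not_less)
    have "corner \<epsilon> (\<epsilon> - L / 2) \<bullet> i < x \<bullet> i" "x \<bullet> i < corner (1 - \<epsilon>) (L / 2 - \<epsilon>) \<bullet> i"
      using x i(1) by (auto simp: mem_box)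
    then have "\<epsilon> < \<bar>(x - y) \<bullet> i\<bar>" using i by (auto simp: corner_inner inner_diff_left split: if_splits)
    also have "\<dots> \<le> norm (x - y)" by (rule Basis_le_norm[OF i(1)])
    finally show "x \<in> inner_parallel (slab e L) \<epsilon>" using xs y(2) by (simp add: inner_parallel_def dist_norm)
  qed
  then have "vol (box (corner \<epsilon> (\<epsilon> - L / 2)) (corner (1 - \<epsilon>) (L / 2 - \<epsilon>))) \<le> vol (inner_parallel (slab e L) \<epsilon>)"
    by (intro measure_mono_fmeasurable lmeasurable_\<Omega>) auto
  then show ?thesis using assms by (subst (asm) measure_box_corner) (auto simp: algebra_simps)
qed

text \<open>The bound is the surface area 2 L^(N-1) + 2 (N-1) L^(N-2) of the box, factored by the
  volume. The collar is compared with the box shrunk by \<epsilon> on all sides, and Bernoulli makes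
  its volume linear in \<epsilon>.\<close>

lemma perimeter_slab_le: "perimeter (slab e L) \<le> vol (slab e L) * (2 + 2 * real (DIM('a) - 1) / L)"
proof (rule perimeter_le[of "min (1 / 2) (L / 2)"])
  fix \<epsilon> assume \<epsilon>: "0 < \<epsilon>" "\<epsilon> < min (1 / 2) (L / 2)"
  let ?n = "DIM('a) - 1"
  let ?V = "vol (slab e L)"
  have B: "1 + ?n * (- (2 * \<epsilon> / L)) \<le> (1 + (- (2 * \<epsilon> / L))) ^ ?n"
    using \<epsilon> L by (intro Bernoulli_inequality) auto
  define m where "m = real ?n / L"
  have m: "0 \<le> m" using L by (simp add: m_def)
  have "1 - (2 + 2 * real ?n / L) * \<epsilon> = 1 - 2 * \<epsilon> - 2 * m * \<epsilon>" by (simp add: m_def algebra_simps)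
  \<comment> \<open>The two sides differ by 4 m \<epsilon>^2.\<close>
  also have "\<dots> \<le> (1 - 2 * \<epsilon>) * (1 - 2 * m * \<epsilon>)" using m \<epsilon> by (simp add: algebra_simps)
  also have "\<dots> = (1 - 2 * \<epsilon>) * (1 + ?n * (- (2 * \<epsilon> / L)))" by (simp add: m_def)
  also have "\<dots> \<le> (1 - 2 * \<epsilon>) * (1 + (- (2 * \<epsilon> / L))) ^ ?n"
    using B \<epsilon> by (intro mult_left_mono) auto
  finally have "1 - (2 + 2 * real ?n / L) * \<epsilon> \<le> (1 - 2 * \<epsilon>) * (1 + (- (2 * \<epsilon> / L))) ^ ?n" .
  then have "(1 - (2 + 2 * real ?n / L) * \<epsilon>) * ?V \<le> ((1 - 2 * \<epsilon>) * (1 + (- (2 * \<epsilon> / L))) ^ ?n) * ?V"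
    by (rule mult_right_mono) auto
  also have "\<dots> = (1 - 2 * \<epsilon>) * (L - 2 * \<epsilon>) ^ ?n"
  proof -
    have "L - 2 * \<epsilon> = (1 + (- (2 * \<epsilon> / L))) * L" using L by (simp add: field_simps)
    then show ?thesis by (simp only: vol_slab power_mult_distrib mult.assoc)
  qed
  also have "\<dots> \<le> vol (inner_parallel (slab e L) \<epsilon>)" by (rule inner_parallel_slab_ge[OF \<epsilon>])
  finally show "?V - vol (inner_parallel (slab e L) \<epsilon>) \<le> ?V * (2 + 2 * real (DIM('a) - 1) / L) * \<epsilon>"
    by (simp add: algebra_simps)
qed (use L in auto)

text \<open>The factor 2^\<beta> from P / V cancels the (1/2)^\<beta> from the moment of the
  profile; the remaining lateral correction tends to 1 as L grows.\<close>

lemma Ffun_slab_le: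
  assumes \<beta>: "1 \<le> \<beta>"
  shows "Ffun \<beta> (slab e L) \<le> (1 + real (DIM('a) - 1) / L) powr \<beta> / (\<beta> + 1)"
proof -
  let ?V = "vol (slab e L)" and ?P = "perimeter (slab e L)"
  have J: "integral (slab e L) (\<lambda>x. dist_bd (slab e L) x powr \<beta>) \<le> ?V * ((1 / 2) powr \<beta> / gbinom (real 1) \<beta>)"
    by (rule powr_integral_le(1)[OF \<beta> inradius_slab_le _ inner_parallel_slab_le]) auto
  have "?P / ?V \<le> 2 + 2 * real (DIM('a) - 1) / L"
    using perimeter_slab_le vol_pos by (simp add: pos_divide_le_eq mult.commute)
  then have "(?P / ?V) powr \<beta> \<le> (2 * (1 + real (DIM('a) - 1) / L)) powr \<beta>"
    using perimeter_pos vol_pos \<beta> by (intro powr_mono2) auto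
  also have "\<dots> = 2 powr \<beta> * (1 + real (DIM('a) - 1) / L) powr \<beta>"
    using L by (intro powr_mult)
  finally have "Ffun \<beta> (slab e L) \<le> (2 powr \<beta> * (1 + real (DIM('a) - 1) / L) powr \<beta>) * (1 / ?V) * (?V * ((1 / 2) powr \<beta> / gbinom (real 1) \<beta>))"
    unfolding Ffun_def using J vol_pos powr_integral_nonneg[OF \<beta>]
    by (intro mult_mono mult_nonneg_nonneg) auto
  also have "\<dots> = (1 + real (DIM('a) - 1) / L) powr \<beta> / (\<beta> + 1)"
    using vol_pos \<beta> by (simp add: gbinom_1 powr_divide)
  finally show ?thesis .
qed

end

lemma Ffun_slab_tendsto:
  fixes e :: "'a::euclidean_space"
  assumes e: "e \<in> Basis" and \<beta>: "1 \<le> \<beta>"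
  shows "((\<lambda>L. Ffun \<beta> (slab e L)) \<longlongrightarrow> 1 / (\<beta> + 1)) at_top"
proof (rule tendsto_sandwich)
  have slab: "slab_domain e L" if "0 < L" for L using e that by unfold_locales
  show "eventually (\<lambda>L. 1 / (\<beta> + 1) \<le> Ffun \<beta> (slab e L)) at_top"
    using eventually_gt_at_top[of 0]
    by eventually_elim (rule bounded_convex_open.Ffun_lower[OF slab_domain.bounded_convex_open_slab[OF slab] \<beta>])
  show "eventually (\<lambda>L. Ffun \<beta> (slab e L) \<le> (1 + real (DIM('a) - 1) / L) powr \<beta> / (\<beta> + 1)) at_top"
    using eventually_gt_at_top[of 0]
    by eventually_elim (rule slab_domain.Ffun_slab_le[OF slab \<beta>])
  have "((\<lambda>L. (1 + real (DIM('a) - 1) / L) powr \<beta> / (\<beta> + 1)) \<longlongrightarrow> (1 + 0) powr \<beta> / (\<beta> + 1)) at_top"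
    using \<beta> by (intro tendsto_intros tendsto_divide_0[OF tendsto_const] filterlim_at_top_imp_at_infinity filterlim_ident) auto
  then show "((\<lambda>L. (1 + real (DIM('a) - 1) / L) powr \<beta> / (\<beta> + 1)) \<longlongrightarrow> 1 / (\<beta> + 1)) at_top" by simp
qed simp

theorem theorem2p8:
  fixes \<Omega> :: "'a::euclidean_space set" and \<beta> :: real
  assumes "DIM('a) \<ge> 2" and "\<beta> \<ge> 1"
    and "bounded \<Omega>" and "convex \<Omega>" and "open \<Omega>" and "\<Omega> \<noteq> {}"
  shows "1 / (\<beta> + 1) \<le> Ffun \<beta> \<Omega> \<and>
    Ffun \<beta> \<Omega> \<le> real DIM('a) powr \<beta> / gbinom (real DIM('a)) \<beta> \<and>
    (Ffun \<beta> \<Omega> = real DIM('a) powr \<beta> / gbinom (real DIM('a)) \<beta> \<longleftrightarrow>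
           vol \<Omega> = perimeter \<Omega> * inradius \<Omega> / real DIM('a)) \<and>
    (\<forall>e\<in>(Basis::'a set). ((\<lambda>L. Ffun \<beta> (slab e L)) \<longlongrightarrow> 1 / (\<beta> + 1)) at_top)"
proof -
  interpret bounded_convex_open \<Omega> by unfold_locales (use assms in auto)
  show ?thesis using Ffun_lower Ffun_upper Ffun_slab_tendsto \<open>\<beta> \<ge> 1\<close> by blast
qed

end
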